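(* Let $(\mathbb{B},\|\cdot\|_{\mathbb{B}})$ be a separable $r$-smooth Banach space for some $r\in(1,2]$ and let $d\geq 1$. For $\boldsymbol{i}\in\mathbb{Z}^d$ and $n\geq1$, let $A_{n,\boldsymbol{i}}\colon\mathbb{B}\to\mathbb{B}$ be a bounded linear operator with operator norm $\|A_{n,\boldsymbol{i}}\|_{\mathcal{B}(\mathbb{B})}$. Let $1<p<r$ and let $$C_{n,p}:=\Big(\sum_{\boldsymbol{i}\in\mathbb{Z}^d}\|A_{n,\boldsymbol{i}}\|_{\mathcal{B}(\mathbb{B})}^p\Big)^{1/p},$$ assumed finite for every $n$. Let $(X_{\boldsymbol{i}})_{\boldsymbol{i}\in\mathbb{Z}^d}$ be an identically distributed $\mathbb{B}$-valued orthomartingale difference random field and assume that $\|X_{\boldsymbol{1}}\|_{\mathbb{B}}\in\mathbb{L}^s$ for some $s>p$. Then for each $\varepsilon>0$ and each increasing sequence of positive numbers $(R_n)_{n\geq1}$ such that $R_n\to\infty$ (with $R_0:=0$), $$\sum_{n\geq1}(R_n^s-R_{n-1}^s)\,\mathbb{P}\left(\Big\|\sum_{\boldsymbol{i}\in\mathbb{Z}^d}A_{n,\boldsymbol{i}}(X_{\boldsymbol{i}})\Big\|_{\mathbb{B}}>\varepsilon\,C_{n,p}R_n\right)<\infty.$$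
   Context: The series $\sum_{\boldsymbol{i}\in\mathbb{Z}^d}A_{n,\boldsymbol{i}}(X_{\boldsymbol{i}})$ is understood as the limit in $\mathbb{L}^p$ of its finite partial sums. The operator norm is $\|A\|_{\mathcal{B}(\mathbb{B})}=\sup\{\|A(x)\|_{\mathbb{B}}/\|x\|_{\mathbb{B}}:x\in\mathbb{B}\setminus\{0\}\}$. For $\boldsymbol{i},\boldsymbol{j}\in\mathbb{Z}^d$, $\boldsymbol{i}\preccurlyeq\boldsymbol{j}$ means $i_\ell\leq j_\ell$ for all $\ell$; $\min\{\boldsymbol{i},\boldsymbol{j}\}$ is the coordinatewise minimum; $\boldsymbol{1}=(1,\dots,1)$; $\boldsymbol{e}_\ell$ is the $\ell$-th canonical basis vector. A separable Banach space $\mathbb{B}$ is $r$-smooth ($1<r\leq2$) if there is an equivalent norm $\|\cdot\|'_{\mathbb{B}}$ with $\sup_{t>0}\sup_{\|x\|'_{\mathbb{B}}=\|y\|'_{\mathbb{B}}=1}\frac{\|x+ty\|'_{\mathbb{B}}+\|x-ty\|'_{\mathbb{B}}-2}{t^r}<\infty$. A completely commuting filtration is a family $(\mathcal{F}_{\boldsymbol{i}})_{\boldsymbol{i}\in\mathbb{Z}^d}$ of sub-$\sigma$-algebras with $\mathcal{F}_{\boldsymbol{i}}\subset\mathcal{F}_{\boldsymbol{j}}$ whenever $\boldsymbol{i}\preccurlyeq\boldsymbol{j}$ and $\mathbb{E}[\mathbb{E}[Y\mid\mathcal{F}_{\boldsymbol{i}}]\mid\mathcal{F}_{\boldsymbol{j}}]=\mathbb{E}[Y\mid\mathcal{F}_{\min\{\boldsymbol{i},\boldsymbol{j}\}}]$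 for all $Y\in\mathbb{L}^1$ and all $\boldsymbol{i},\boldsymbol{j}$. $(X_{\boldsymbol{i}})$ is an orthomartingale difference random field if, for some completely commuting filtration $(\mathcal{F}_{\boldsymbol{i}})$ and each $\boldsymbol{i}$, $\|X_{\boldsymbol{i}}\|_{\mathbb{B}}$ is integrable, $X_{\boldsymbol{i}}$ is $\mathcal{F}_{\boldsymbol{i}}$-measurable, and $\mathbb{E}[X_{\boldsymbol{i}}\mid\mathcal{F}_{\boldsymbol{i}-\boldsymbol{e}_\ell}]=0$ for every $\ell\in\{1,\dots,d\}$. Identically distributed means that all $X_{\boldsymbol{i}}$ have the same law. *)

theory Defs
  imports "HOL-Probability.Probability"
begin

definition equivalent_norm :: "('b::real_normed_vector \<Rightarrow> real) \<Rightarrow> bool" where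
  "equivalent_norm N \<longleftrightarrow>
     (\<forall>x. 0 \<le> N x) \<and> (\<forall>x. N x = 0 \<longleftrightarrow> x = 0) \<and>
     (\<forall>c x. N (c *\<^sub>R x) = \<bar>c\<bar> * N x) \<and>
     (\<forall>x y. N (x + y) \<le> N x + N y) \<and>
     (\<exists>a>0. \<exists>b>0. \<forall>x. a * norm x \<le> N x \<and> N x \<le> b * norm x)"

text \<open>The bound \<open>K\<close> expresses that the supremum over all \<open>t > 0\<close> and all
  \<open>x\<close>, \<open>y\<close> in the unit sphere of the equivalent norm is finite.\<close>

definition r_smooth :: "'b::real_normed_vector itself \<Rightarrow> real \<Rightarrow> bool" where
  "r_smooth _ r \<longleftrightarrow>
     (\<exists>N :: 'b \<Rightarrow> real. equivalent_norm N \<and>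
        (\<exists>K. \<forall>t>0. \<forall>x y. N x = 1 \<and> N y = 1 \<longrightarrow>
           (N (x + t *\<^sub>R y) + N (x - t *\<^sub>R y) - 2) / t powr r \<le> K))"

text \<open>\<open>Y\<close> is a version of the conditional expectation of the Banach-valued \<open>X\<close> given \<open>G\<close>;
  the library's \<open>real_cond_exp\<close> only covers real-valued functions.\<close>

definition is_cond_exp ::
    "'a measure \<Rightarrow> 'a measure \<Rightarrow> ('a \<Rightarrow> 'b::{banach, second_countable_topology}) \<Rightarrow> ('a \<Rightarrow> 'b) \<Rightarrow> bool" where
  "is_cond_exp M G X Y \<longleftrightarrow>
     integrable M X \<and> integrable M Y \<and> Y \<in> borel_measurable G \<and>
     (\<forall>B\<in>sets G. (LINT \<omega>:B|M. X \<omega>) = (LINT \<omega>:B|M. Y \<omega>))"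

text \<open>The multi-indices are the elements of \<^typ>\<open>int ^ 'd\<close>, with \<open>CARD('d)\<close> the dimension; the
  library's order on this type is the coordinatewise one, and its \<open>1\<close> is the vector
  \<open>(1, \<dots>, 1)\<close>. A sub-\<open>\<sigma>\<close>-algebra is represented by a measure of which only the
  \<open>\<sigma>\<close>-algebra matters.\<close>

definition completely_commuting_filtration ::
    "'a measure \<Rightarrow> (int ^ 'd \<Rightarrow> 'a measure) \<Rightarrow> bool" where
  "completely_commuting_filtration M F \<longleftrightarrow>
     (\<forall>i. subalgebra M (F i)) \<and>
     (\<forall>i j. i \<le> j \<longrightarrow> sets (F i) \<subseteq> sets (F j)) \<and>
     (\<forall>Y i j. integrable M Y \<longrightarrow>
        (AE \<omega> in M. real_cond_exp M (F j) (real_cond_exp M (F i) Y) \<omega> =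
                    real_cond_exp M (F (\<chi> l. min (i $ l) (j $ l))) Y \<omega>))"

definition orthomartingale_difference ::
    "'a measure \<Rightarrow> (int ^ 'd \<Rightarrow> 'a \<Rightarrow> 'b::{banach, second_countable_topology}) \<Rightarrow> bool" where
  "orthomartingale_difference M X \<longleftrightarrow>
     (\<exists>F. completely_commuting_filtration M F \<and>
        (\<forall>i. integrable M (\<lambda>\<omega>. norm (X i \<omega>)) \<and>
             X i \<in> borel_measurable (F i) \<and>
             (\<forall>l. is_cond_exp M (F (i - axis l 1)) (X i) (\<lambda>_. 0))))"

definition identically_distributed ::
    "'a measure \<Rightarrow> ('i \<Rightarrow> 'a \<Rightarrow> 'b::topological_space) \<Rightarrow> bool" where
  "identically_distributed M X \<longleftrightarrow> (\<forall>i j. distr M borel (X i) = distr M borel (X j))"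

text \<open>\<open>S\<close> is the limit in \<open>L\<^sup>p\<close> of the partial sums of \<open>Y\<close> over finite index sets, along the net of
  all finite subsets of the index type. The distance is a nonnegative integral because the
  Bochner integral of a non-integrable function is \<open>0\<close>.\<close>

definition has_Lp_sum ::
    "'a measure \<Rightarrow> real \<Rightarrow> ('i \<Rightarrow> 'a \<Rightarrow> 'b::{banach, second_countable_topology}) \<Rightarrow> ('a \<Rightarrow> 'b) \<Rightarrow> bool" where
  "has_Lp_sum M p Y S \<longleftrightarrow>
     S \<in> borel_measurable M \<and> integrable M (\<lambda>\<omega>. norm (S \<omega>) powr p) \<and>
     ((\<lambda>J. \<integral>\<^sup>+ \<omega>. ennreal (norm ((\<Sum>i\<in>J. Y i \<omega>) - S \<omega>) powr p) \<partial>M) \<longlongrightarrow> 0)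
       (finite_subsets_at_top UNIV)"

text \<open>The norm of a bounded linear function is its operator norm (\<open>norm_blinfun.rep_eq\<close>,
  \<open>onorm_def\<close>).\<close>

definition lp_coeff_norm ::
    "real \<Rightarrow> ('i \<Rightarrow> 'b::real_normed_vector \<Rightarrow>\<^sub>L 'b) \<Rightarrow> real" where
  "lp_coeff_norm p a = (\<Sum>\<^sub>\<infinity>i. norm (a i) powr p) powr (1 / p)"

end

theory Submission
  imports Defs
begin

text \<open>
  Fix a smooth equivalent norm \<open>N\<close> and exponents \<open>p < r\<close> and \<open>q
  \<ge> p\<close>. Smoothness gives the two-point inequality \<open>N (x + y)^q + N (x - y)^q
  \<le> 2 (N x^p + K N y^p)^(q/p)\<close>. Integrated, it says that the Banach space
  \<open>L\<^sup>q\<close> of vector-valued functions is itself smooth, with exponent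
  \<open>p\<close>. If \<open>D\<close> has conditional expectation zero given a
  \<open>\<sigma>\<close>-algebra for which \<open>S\<close> is measurable, Jensen's inequality
  gives \<open>\<parallel>S\<parallel> \<le> \<parallel>S - D\<parallel>\<close> in
  \<open>L\<^sup>q\<close>, and the two facts combine to \<open>\<parallel>S + D\<parallel>^p
  \<le> \<parallel>S\<parallel>^p + 2 K \<parallel>D\<parallel>^p\<close>
  (\<open>Lq_norm_martingale_step\<close>). Since the right-hand side involves only norms in
  \<open>L\<^sup>q\<close>, the inequality can be applied to one coordinate of the index after
  the other, and an orthomartingale sum satisfies \<open>\<parallel>\<Sum>
  Y\<^sub>i\<parallel>^p \<le> (2 K)^d \<Sum> \<parallel>Y\<^sub>i\<parallel>^p\<close>
  (\<open>Lq_norm_orth_sum\<close>). With \<open>Y\<^sub>i = A\<^sub>i X\<^sub>i\<close>, only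
  the sum of \<open>\<parallel>A\<^sub>i\<parallel>^p\<close> enters. The case \<open>q =
  p\<close> shows that the partial sums are Cauchy in \<open>L\<^sup>p\<close>, hence the
  existence of the series.

  The summability over \<open>n\<close> is a Marcinkiewicz interpolation between the exponents
  \<open>p < s < 2 s\<close>. At level \<open>R\<close> the field is split at
  \<open>\<parallel>X\<^sub>i\<parallel> = R\<close>. A truncated field is no longer an
  orthomartingale difference field, so its bounded part is projected back by \<open>D\<^sub>i Z
  = \<Sum>\<^sub>S (-1)^|S| E[Z | F\<^bsub>i - 1\<^sub>S\<^esub>]\<close>, with \<open>S\<close>
  ranging over the sets of coordinates; complete commutation makes the terms cancel in pairs in
  \<open>E[D\<^sub>i Z | F\<^sub>j]\<close> unless \<open>i \<le> j\<close>
  (\<open>orth_projection_orth\<close>). Applying this projection only to functions with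
  finitely many values reduces all the conditional expectations that have to be constructed to
  real ones. The remainder \<open>X\<^sub>i - D\<^sub>i Z\<close> is a signed sum of conditional
  expectations of \<open>X\<^sub>i - Z\<close>, because those of \<open>X\<^sub>i\<close> given
  \<open>F\<^bsub>i - 1\<^sub>S\<^esub>\<close> vanish for nonempty \<open>S\<close>. Markov's
  inequality with exponent \<open>2 s\<close> for the bounded part and \<open>p\<close> for the
  remainder bounds the tail at \<open>\<epsilon> C R\<close> by a multiple of
  \<open>E[(\<parallel>X\<parallel>/R)^(2s) 1{\<parallel>X\<parallel> \<le> R} +
  (\<parallel>X\<parallel>/R)^p 1{\<parallel>X\<parallel> > R}]\<close>, with a constant that
  does not depend on the operators (\<open>weighted_series_tail_bound\<close>). Inside the
  expectation, the sum of these quantities with the weights \<open>R\<^sub>n^s -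
  R\<^bsub>n-1\<^esub>^s\<close> telescopes to at most a multiple of
  \<open>\<parallel>X\<parallel>^s\<close> (\<open>sum_weighted_truncated_powers_le\<close>).
\<close>

section \<open>Powers and smooth norms\<close>

lemma convex_on_powr_nonneg:
  fixes q :: real
  assumes q: "1 \<le> q"
  shows "convex_on {0..} (\<lambda>x. x powr q)"
proof (rule convex_onI)
  fix t x y :: real
  assume t: "0 < t" "t < 1" and x: "x \<in> {0..}" and y: "y \<in> {0..}"
  have scale: "(u * z) powr q \<le> u * z powr q" if "0 < u" "u < 1" "0 \<le> z" for u z :: real
  proof -
    have "u powr q \<le> u powr 1" using that q by (intro powr_mono') auto
    then show ?thesis using that by (simp add: powr_mult mult_right_mono)
  qed
  show "((1 - t) *\<^sub>R x + t *\<^sub>R y) powr q \<le> (1 - t) * x powr q + t * y powr q"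
  proof (cases "x = 0 \<or> y = 0")
    case True
    then show ?thesis using scale[of t y] scale[of "1-t" x] t x y q by auto
  next
    case False
    then have "x \<in> {0<..}" "y \<in> {0<..}" using x y by auto
    then show ?thesis
      using convex_onD[OF powr_convex[OF q], of t x y] t by simp
  qed
qed auto

lemma convex_on_abs_powr:
  fixes q :: real
  assumes q: "1 \<le> q"
  shows "convex_on UNIV (\<lambda>x::real. \<bar>x\<bar> powr q)"
proof (rule convex_onI)
  fix t x y :: real
  assume t: "0 < t" "t < 1"
  have "\<bar>(1 - t) *\<^sub>R x + t *\<^sub>R y\<bar> \<le> \<bar>(1-t) * x\<bar> + \<bar>t * y\<bar>"
    unfolding real_scaleR_def by (rule abs_triangle_ineq)
  also have "\<dots> = (1-t) * \<bar>x\<bar> + t * \<bar>y\<bar>"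
    using t by (simp add: abs_mult)
  finally have "\<bar>(1 - t) *\<^sub>R x + t *\<^sub>R y\<bar> powr q \<le> ((1 - t) * \<bar>x\<bar> + t * \<bar>y\<bar>) powr q"
    using q by (intro powr_mono2) auto
  also have "\<dots> \<le> (1 - t) * \<bar>x\<bar> powr q + t * \<bar>y\<bar> powr q"
    using convex_onD[OF convex_on_powr_nonneg[OF q], of t "\<bar>x\<bar>" "\<bar>y\<bar>"] t by simp
  finally show "\<bar>(1 - t) *\<^sub>R x + t *\<^sub>R y\<bar> powr q \<le> (1 - t) * \<bar>x\<bar> powr q + t * \<bar>y\<bar> powr q" .
qed auto

lemma powr_add_le:
  fixes a b q :: real
  assumes "0 \<le> a" "0 \<le> b" "1 \<le> q"
  shows "(a + b) powr q \<le> 2 powr q * (a powr q + b powr q)"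
proof -
  have "(a + b) powr q \<le> (2 * max a b) powr q" using assms by (intro powr_mono2) auto
  also have "\<dots> = 2 powr q * (max a b) powr q" using assms by (simp add: powr_mult)
  also have "\<dots> \<le> 2 powr q * (a powr q + b powr q)"
    by (intro mult_left_mono) (auto simp: max_def)
  finally show ?thesis .
qed

lemma two_powr_add_le:
  fixes a b u :: real
  assumes a: "0 \<le> a" and b: "0 \<le> b" and u: "1 \<le> u"
  shows "2 * (a + b) powr u \<le> a powr u + (a + 2 * b) powr u"
proof -
  have "(1 - 1/2) *\<^sub>R a + (1/2) *\<^sub>R (a + 2 * b) = a + b" by (simp add: field_simps)
  then show ?thesis
    using convex_onD[OF convex_on_powr_nonneg[OF u], of "1/2" a "a + 2 * b"] a b by simp
qed

text \<open>Both \<open>1 + a \<le> exp a\<close> and the second-order Taylor bound for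
  \<open>exp\<close> are valid up to \<open>a = -1\<close>, where \<open>(1 + a) powr q\<close>
  itself need not be twice differentiable.\<close>

lemma powr_one_plus_le_quadratic:
  fixes q a :: real
  assumes q: "0 \<le> q" and a: "\<bar>a\<bar> \<le> 1"
  shows "(1 + a) powr q \<le> 1 + q * a + q\<^sup>2 * exp q * a\<^sup>2"
proof -
  have "(1 + a) powr q \<le> exp (q * a)"
  proof (cases "1 + a = 0")
    case False
    then have pos: "1 + a > 0" using a by simp
    then have "ln (1 + a) \<le> a" using ln_le_minus_one[of "1+a"] by simp
    then have "q * ln (1 + a) \<le> q * a" using q by (rule mult_left_mono)
    then show ?thesis using pos by (simp add: powr_def)
  qed simp
  moreover have "exp (q * a) - (1 + q * a) \<le> exp \<bar>q * a\<bar> * (q * a)\<^sup>2"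
  proof -
    have "norm (exp (complex_of_real (q*a)) - (\<Sum>k\<le>1. complex_of_real (q*a) ^ k / fact k))
        \<le> exp\<bar>Re (complex_of_real (q*a))\<bar> * norm (complex_of_real (q*a)) ^ Suc 1 / fact 1"
      by (rule Taylor_exp)
    moreover have "exp (complex_of_real (q*a)) - (\<Sum>k\<le>1. complex_of_real (q*a) ^ k / fact k)
        = complex_of_real (exp (q*a) - (1 + q * a))"
      by (simp flip: exp_of_real)
    ultimately have "\<bar>exp (q*a) - (1 + q*a)\<bar> \<le> exp \<bar>q*a\<bar> * \<bar>q*a\<bar> ^ 2"
      by (simp only: norm_of_real) (simp add: numeral_2_eq_2)
    then show ?thesis by simp
  qed
  moreover have "exp \<bar>q * a\<bar> * (q * a)\<^sup>2 \<le> exp q * (q * a)\<^sup>2"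
  proof (intro mult_right_mono)
    have "\<bar>q * a\<bar> \<le> q * 1" unfolding abs_mult using q a by (intro mult_mono) auto
    then show "exp \<bar>q * a\<bar> \<le> exp q" by simp
  qed simp
  ultimately show ?thesis by (simp add: power_mult_distrib mult_ac)
qed

lemma equivalent_normD:
  assumes "equivalent_norm N"
  shows "0 \<le> N x" and "N x = 0 \<longleftrightarrow> x = 0" and "N (c *\<^sub>R x) = \<bar>c\<bar> * N x"
    and "N (x + y) \<le> N x + N y"
  using assms unfolding equivalent_norm_def by auto

lemma equivalent_norm_zero: "equivalent_norm N \<Longrightarrow> N 0 = 0"
  by (simp add: equivalent_normD)

lemma equivalent_norm_minus: "equivalent_norm N \<Longrightarrow> N (- x) = N x"
  using equivalent_normD(3)[of N "-1" x] by simp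

lemma equivalent_norm_diff: "equivalent_norm N \<Longrightarrow> N (x - y) \<le> N x + N y"
  using equivalent_normD(4)[of N x "- y"] by (simp add: equivalent_norm_minus)

lemma equivalent_norm_bounds:
  fixes N :: "'b::real_normed_vector \<Rightarrow> real"
  assumes "equivalent_norm N"
  obtains c where "c \<ge> 1" "\<And>x :: 'b. N x \<le> c * norm x" "\<And>x :: 'b. norm x \<le> c * N x"
proof -
  obtain a b where a: "a > 0" and b: "b > 0" and ab: "\<And>x::'b. a * norm x \<le> N x" "\<And>x. N x \<le> b * norm x"
    using assms unfolding equivalent_norm_def by blast
  define c where "c = max 1 (max b (1/a))"
  show thesis
  proof (rule that[of c])
    show "c \<ge> 1" by (simp add: c_def)
    fix x :: 'b
    have "b * norm x \<le> c * norm x" by (intro mult_right_mono) (auto simp: c_def)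
    then show "N x \<le> c * norm x" using ab(2)[of x] by simp
    have "1/a * N x \<le> c * N x"
      by (intro mult_right_mono) (auto simp: c_def equivalent_normD[OF assms])
    moreover have "norm x \<le> 1/a * N x" using ab(1)[of x] a by (simp add: field_simps)
    ultimately show "norm x \<le> c * N x" by simp
  qed
qed

lemma continuous_on_equivalent_norm:
  fixes N :: "'b::real_normed_vector \<Rightarrow> real"
  assumes N: "equivalent_norm N"
  shows "continuous_on UNIV N"
proof -
  obtain c where c: "c \<ge> 1" "\<And>x. N x \<le> c * norm x"
    using equivalent_norm_bounds[OF N] by metis
  have "\<bar>N x - N y\<bar> \<le> c * norm (x - y)" for x y
    using equivalent_normD(4)[OF N, of "x - y" y] equivalent_normD(4)[OF N, of "y - x" x] c(2)[of "x - y"] c(2)[of "y - x"]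
    by (simp add: norm_minus_commute)
  then have "c-lipschitz_on UNIV N"
    using c(1) by (intro lipschitz_onI) (auto simp: dist_norm)
  then show ?thesis by (rule lipschitz_on_continuous_on)
qed

lemma equivalent_norm_measurable:
  fixes N :: "'b::real_normed_vector \<Rightarrow> real"
  assumes N: "equivalent_norm N"
  shows "N \<in> borel_measurable borel"
  using continuous_on_equivalent_norm[OF N] by (rule borel_measurable_continuous_onI)

lemma equivalent_norm_norm: "equivalent_norm (norm :: 'b::real_normed_vector \<Rightarrow> real)"
  unfolding equivalent_norm_def
  by (auto simp: norm_triangle_ineq intro!: exI[of _ 1])

text \<open>Smoothness in integrated form: the \<open>q\<close>-th powers on the left make the
  inequality survive integration, for every \<open>q \<ge> p\<close>, so that
  \<open>L\<^sup>q\<close> inherits it (for \<open>q = p\<close> it is the usual two-point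
  characterisation of a \<open>p\<close>-smooth norm).\<close>

definition smooth_two_point :: "('b::real_normed_vector \<Rightarrow> real) \<Rightarrow> real \<Rightarrow> real \<Rightarrow> real \<Rightarrow> bool" where
  "smooth_two_point N p q K \<longleftrightarrow>
     (\<forall>x y. N (x + y) powr q + N (x - y) powr q \<le> 2 * (N x powr p + K * N y powr p) powr (q / p))"

text \<open>By homogeneity \<open>N x = 1\<close> and \<open>N y = t\<close>. For \<open>t \<ge>
  1\<close> the triangle inequality suffices. For \<open>t < 1\<close> write the two norms as
  \<open>1 + a\<close> and \<open>1 + b\<close>: smoothness bounds the first-order term \<open>q
  (a + b)\<close> by a multiple of \<open>t^r\<close>, the quadratic terms are of order
  \<open>t\<^sup>2\<close>, and both are at most \<open>t^p\<close>.\<close>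

lemma smooth_two_point_ex:
  fixes N :: "'b::real_normed_vector \<Rightarrow> real"
  assumes N: "equivalent_norm N"
    and sm: "\<forall>t>0. \<forall>x y. N x = 1 \<and> N y = 1 \<longrightarrow> (N (x + t *\<^sub>R y) + N (x - t *\<^sub>R y) - 2) / t powr r \<le> K0"
    and r: "r \<le> 2" and p: "1 < p" "p < r" and q: "p \<le> q"
  shows "\<exists>K\<ge>0. smooth_two_point N p q K"
proof -
  note Nn = equivalent_normD[OF N]
  define c where "c = q\<^sup>2 * exp q"
  define K where "K = 2 powr p + q * \<bar>K0\<bar> + 2 * c"
  have c0: "c \<ge> 0" by (simp add: c_def)
  have K2: "K \<ge> 2 powr p" using p q c0 by (simp add: K_def)
  have K0': "K \<ge> 0" using K2 powr_ge_zero[of 2 p] by linarith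
  have K1: "K \<ge> 1" using K2 ge_one_powr_ge_zero[of 2 p] p by linarith
  have unit: "N (x + t *\<^sub>R y) powr q + N (x - t *\<^sub>R y) powr q \<le> 2 * (1 + K * t powr p) powr (q / p)"
    if x: "N x = 1" and y: "N y = 1" and t: "t > 0" for x y t
  proof -
    have up: "N (x + t *\<^sub>R y) \<le> 1 + t" "N (x - t *\<^sub>R y) \<le> 1 + t"
      using Nn(4)[of x "t *\<^sub>R y"] equivalent_norm_diff[OF N, of x "t *\<^sub>R y"] x y t by (auto simp: Nn(3))
    show ?thesis
    proof (cases "t \<ge> 1")
      case True
      have "N (x + t *\<^sub>R y) powr q + N (x - t *\<^sub>R y) powr q \<le> (2*t) powr q + (2*t) powr q"
        using up True p q by (intro add_mono powr_mono2) (auto simp: Nn)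
      also have "\<dots> = 2 * ((2*t) powr p) powr (q/p)" using p by (simp add: powr_powr)
      also have "\<dots> \<le> 2 * (1 + K * t powr p) powr (q / p)"
      proof (intro mult_left_mono powr_mono2)
        have "(2*t) powr p = 2 powr p * t powr p" using t by (simp add: powr_mult)
        also have "\<dots> \<le> K * t powr p" using K2 by (intro mult_right_mono) auto
        finally show "(2*t) powr p \<le> 1 + K * t powr p" by simp
      qed (use p q in auto)
      finally show ?thesis .
    next
      case False
      then have t1: "t < 1" by simp
      define a where "a = N (x + t *\<^sub>R y) - 1"
      define b where "b = N (x - t *\<^sub>R y) - 1"
      have lo: "1 \<le> N (x + t *\<^sub>R y) + t" "1 \<le> N (x - t *\<^sub>R y) + t"
        using equivalent_norm_diff[OF N, of "x + t *\<^sub>R y" "t *\<^sub>R y"] Nn(4)[of "x - t *\<^sub>R y" "t *\<^sub>R y"] x y t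
        by (auto simp: Nn(3))
      have at: "\<bar>a\<bar> \<le> t" and bt: "\<bar>b\<bar> \<le> t" using up lo by (auto simp: a_def b_def)
      have ab: "a + b \<le> \<bar>K0\<bar> * t powr r"
      proof -
        have "(a + b) / t powr r \<le> K0" using sm x y t by (simp add: a_def b_def diff_add_eq)
        then have "a + b \<le> K0 * t powr r" using t by (simp add: divide_le_eq)
        also have "\<dots> \<le> \<bar>K0\<bar> * t powr r" by (intro mult_right_mono) auto
        finally show ?thesis .
      qed
      have sq: "z\<^sup>2 \<le> t powr p" if "\<bar>z\<bar> \<le> t" for z
      proof -
        have "z\<^sup>2 \<le> t\<^sup>2" using that by (rule abs_le_square_iff[THEN iffD1, OF order_trans[OF _ abs_ge_self]])
        also have "\<dots> = t powr 2" using t by simp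
        also have "\<dots> \<le> t powr p" using t t1 p r by (intro powr_mono') auto
        finally show ?thesis .
      qed
      have tr: "t powr r \<le> t powr p" using t t1 p r by (intro powr_mono') auto
      have "N (x + t *\<^sub>R y) powr q + N (x - t *\<^sub>R y) powr q = (1 + a) powr q + (1 + b) powr q"
        by (simp add: a_def b_def)
      also have "\<dots> \<le> (1 + q * a + c * a\<^sup>2) + (1 + q * b + c * b\<^sup>2)"
        unfolding c_def using at bt t1 p q by (intro add_mono powr_one_plus_le_quadratic) auto
      also have "\<dots> = 2 + q * (a + b) + c * a\<^sup>2 + c * b\<^sup>2" by (simp add: algebra_simps)
      also have "\<dots> \<le> 2 + q * (\<bar>K0\<bar> * t powr p) + c * t powr p + c * t powr p"
        using ab tr p q c0 sq[OF at] sq[OF bt] order_trans[OF ab mult_left_mono[OF tr abs_ge_zero]]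
        by (intro add_mono mult_left_mono) auto
      also have "\<dots> = 2 + (q * \<bar>K0\<bar> + 2 * c) * t powr p" by (simp add: algebra_simps)
      also have "\<dots> \<le> 2 + 2 * K * t powr p"
      proof -
        have "q * \<bar>K0\<bar> + 2 * c \<le> K" by (simp add: K_def)
        also have "K \<le> 2 * K" using K0' by simp
        finally show ?thesis by (simp add: mult_right_mono)
      qed
      also have "\<dots> = 2 * (1 + K * t powr p) powr 1" using K0' by (simp add: add_nonneg_nonneg)
      also have "\<dots> \<le> 2 * (1 + K * t powr p) powr (q / p)"
        using K0' p q by (intro mult_left_mono powr_mono) auto
      finally show ?thesis .
    qed
  qed
  have "N (x + y) powr q + N (x - y) powr q \<le> 2 * (N x powr p + K * N y powr p) powr (q / p)" for x y
  proof -
    consider "y = 0" | "x = 0" "y \<noteq> 0" | "x \<noteq> 0" "y \<noteq> 0" by blast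
    then show ?thesis
    proof cases
      case 1
      then show ?thesis using p q by (simp add: equivalent_norm_zero[OF N] powr_powr)
    next
      case 2
      have "N y powr q = (N y powr p) powr (q / p)" using p by (simp add: powr_powr)
      also have "\<dots> \<le> (K * N y powr p) powr (q / p)"
        using mult_right_mono[OF K1, of "N y powr p"] p q by (intro powr_mono2) auto
      finally show ?thesis using 2 p q
        by (simp add: equivalent_norm_zero[OF N] equivalent_norm_minus[OF N])
    next
      case 3
      define a where "a = N x"
      define b where "b = N y"
      have a: "a > 0" and b: "b > 0" using 3 Nn(1)[of x] Nn(1)[of y] Nn(2)[of x] Nn(2)[of y] by (auto simp: a_def b_def less_le)
      define x' where "x' = x /\<^sub>R a"
      define y' where "y' = y /\<^sub>R b"
      have u: "N x' = 1" "N y' = 1" using a b by (auto simp: x'_def y'_def Nn(3) a_def b_def)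
      have e: "x + y = a *\<^sub>R (x' + (b/a) *\<^sub>R y')" "x - y = a *\<^sub>R (x' - (b/a) *\<^sub>R y')"
        using a b by (auto simp: x'_def y'_def algebra_simps)
      have "N (x + y) powr q + N (x - y) powr q
          = a powr q * (N (x' + (b/a) *\<^sub>R y') powr q + N (x' - (b/a) *\<^sub>R y') powr q)"
        unfolding e Nn(3) using a by (simp add: powr_mult Nn algebra_simps)
      also have "\<dots> \<le> a powr q * (2 * (1 + K * (b/a) powr p) powr (q / p))"
        using a b by (intro mult_left_mono unit u) auto
      also have "\<dots> = 2 * ((a powr p) powr (q / p) * (1 + K * (b/a) powr p) powr (q / p))"
        using p by (simp add: powr_powr)
      also have "(a powr p) powr (q / p) * (1 + K * (b/a) powr p) powr (q / p)
          = (a powr p * (1 + K * (b/a) powr p)) powr (q / p)"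
        using K0' by (simp add: powr_mult)
      also have "a powr p * (1 + K * (b/a) powr p) = a powr p + K * b powr p"
        using a b by (simp add: powr_divide algebra_simps)
      finally show ?thesis by (simp add: a_def b_def)
    qed
  qed
  then show ?thesis using K0' unfolding smooth_two_point_def by blast
qed

section \<open>Jensen's inequality for Banach-valued conditional expectations\<close>

lemma simple_function_sum_fibres:
  fixes f :: "'a \<Rightarrow> 'b::real_normed_vector"
  assumes "simple_function M f" "x \<in> space M"
  shows "f x = (\<Sum>y\<in>f ` space M. indicator (f -` {y} \<inter> space M) x *\<^sub>R y)"
proof -
  have "(\<Sum>y\<in>f ` space M. indicator (f -` {y} \<inter> space M) x *\<^sub>R y)
      = (\<Sum>y\<in>f ` space M. if f x = y then y else 0)"
    using assms(2) by (intro sum.cong) (auto simp: indicator_def)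
  also have "\<dots> = f x"
    using assms by (subst sum.delta') (auto simp: simple_function_def)
  finally show ?thesis by simp
qed

context prob_space
begin

lemma indicator_scaleR_integral:
  fixes c :: "'b::{banach, second_countable_topology}"
  assumes E: "E \<in> sets M"
  shows "integrable M (\<lambda>x. indicator E x *\<^sub>R c)"
    and "(\<integral>x. indicator E x *\<^sub>R c \<partial>M) = measure M E *\<^sub>R c"
proof -
  have i: "integrable M (indicator E :: 'a \<Rightarrow> real)"
    using E by (rule integrable_real_indicator) (simp add: emeasure_eq_measure)
  show "integrable M (\<lambda>x. indicator E x *\<^sub>R c)"
    by (rule integrable_scaleR_left[OF i])
  show "(\<integral>x. indicator E x *\<^sub>R c \<partial>M) = measure M E *\<^sub>R c"
    by (subst integral_scaleR_left[OF i]) (use E in simp)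
qed

lemma simple_function_integrable:
  fixes f :: "'a \<Rightarrow> 'b::{banach, second_countable_topology}"
  assumes "simple_function M f"
  shows "integrable M f"
proof -
  have "finite (f ` space M)" using assms by (rule simple_functionD)
  then have "bounded (f ` space M)" by (rule finite_imp_bounded)
  then obtain B where "\<And>x. x \<in> space M \<Longrightarrow> norm (f x) \<le> B"
    by (auto simp: bounded_iff)
  then show ?thesis
    using borel_measurable_simple_function[OF assms] by (intro integrable_const_bound[of _ B]) auto
qed

lemma equivalent_norm_integrable:
  fixes f :: "'a \<Rightarrow> 'b::{banach, second_countable_topology}"
  assumes N: "equivalent_norm N" and f: "integrable M f"
  shows "integrable M (\<lambda>x. N (f x))"
proof -
  obtain c where c: "c \<ge> 1" "\<And>x. N x \<le> c * norm x"
    using equivalent_norm_bounds[OF N] by metis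
  note equivalent_norm_measurable[OF N, measurable]
  have [measurable]: "f \<in> borel_measurable M" using f by auto
  show ?thesis
  proof (rule Bochner_Integration.integrable_bound[of M "\<lambda>x. c * norm (f x)"])
    show "AE x in M. norm (N (f x)) \<le> norm (c * norm (f x))"
      using c equivalent_normD(1)[OF N] by (auto intro: order_trans)
  qed (use f in auto)
qed

text \<open>For finitely many values this is the triangle inequality; dominated convergence along
  simple functions, together with continuity of \<open>N\<close>, gives the general case.\<close>

lemma equivalent_norm_integral_le:
  fixes f :: "'a \<Rightarrow> 'b::{banach, second_countable_topology}"
  assumes N: "equivalent_norm N" and f: "integrable M f"
  shows "N (\<integral>x. f x \<partial>M) \<le> (\<integral>x. N (f x) \<partial>M)"
proof -
  note equivalent_norm_measurable[OF N, measurable]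
  note Nn = equivalent_normD[OF N]
  obtain c where c: "c \<ge> 1" "\<And>x. N x \<le> c * norm x"
    using equivalent_norm_bounds[OF N] by metis
  have fm[measurable]: "f \<in> borel_measurable M" using f by auto
  have simple: "N (\<integral>x. g x \<partial>M) \<le> (\<integral>x. N (g x) \<partial>M)" if g: "simple_function M g" for g :: "'a \<Rightarrow> 'b"
  proof -
    define Y where "Y = g ` space M"
    define E where "E y = g -` {y} \<inter> space M" for y
    have fin: "finite Y" using g unfolding Y_def by (rule simple_functionD)
    have E[measurable]: "E y \<in> sets M" for y using g unfolding E_def by (rule simple_functionD)
    have "(\<integral>x. g x \<partial>M) = (\<integral>x. (\<Sum>y\<in>Y. indicator (E y) x *\<^sub>R y) \<partial>M)"
      unfolding Y_def E_def
      by (intro Bochner_Integration.integral_cong refl simple_function_sum_fibres[OF g])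
    also have "\<dots> = (\<Sum>y\<in>Y. measure M (E y) *\<^sub>R y)"
      by (subst Bochner_Integration.integral_sum) (auto simp only: indicator_scaleR_integral[OF E])
    finally have "N (\<integral>x. g x \<partial>M) = N (\<Sum>y\<in>Y. measure M (E y) *\<^sub>R y)" by simp
    also have "\<dots> \<le> (\<Sum>y\<in>Y. N (measure M (E y) *\<^sub>R y))"
      using fin
    proof (induction Y rule: finite_induct)
      case empty
      then show ?case by (simp add: equivalent_norm_zero[OF N])
    next
      case (insert y Y)
      then show ?case using Nn(4)[of "measure M (E y) *\<^sub>R y" "\<Sum>y\<in>Y. measure M (E y) *\<^sub>R y"] by simp
    qed
    also have "\<dots> = (\<Sum>y\<in>Y. measure M (E y) *\<^sub>R N y)" by (simp add: Nn)
    also have "\<dots> = (\<integral>x. (\<Sum>y\<in>Y. indicator (E y) x *\<^sub>R N y) \<partial>M)"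
      by (subst Bochner_Integration.integral_sum) (auto simp only: indicator_scaleR_integral[OF E])
    also have "\<dots> = (\<integral>x. N (g x) \<partial>M)"
    proof (rule Bochner_Integration.integral_cong)
      fix x assume x: "x \<in> space M"
      have "(\<Sum>y\<in>Y. indicator (E y) x *\<^sub>R N y) = (\<Sum>y\<in>Y. if g x = y then N y else 0)"
        using x by (intro sum.cong) (auto simp: E_def indicator_def)
      also have "\<dots> = N (g x)" using fin x by (subst sum.delta') (auto simp: Y_def)
      finally show "(\<Sum>y\<in>Y. indicator (E y) x *\<^sub>R N y) = N (g x)" .
    qed simp
    finally show ?thesis .
  qed
  obtain g where g: "\<And>i. simple_function M (g i)" "\<And>x. x \<in> space M \<Longrightarrow> (\<lambda>i. g i x) \<longlonglongrightarrow> f x"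
    "\<And>i x. x \<in> space M \<Longrightarrow> dist (g i x) 0 \<le> 2 * dist (f x) 0"
    using borel_measurable_implies_sequence_metric[OF fm, of 0] by metis
  have gm[measurable]: "g i \<in> borel_measurable M" for i using g(1) by (rule borel_measurable_simple_function)
  have i2: "integrable M (\<lambda>x. 2 * norm (f x))" "integrable M (\<lambda>x. c * (2 * norm (f x)))" using f by auto
  have 1: "(\<lambda>i. \<integral>x. g i x \<partial>M) \<longlonglongrightarrow> (\<integral>x. f x \<partial>M)"
    using g i2 by (intro integral_dominated_convergence[where w = "\<lambda>x. 2 * norm (f x)"]) (auto simp: dist_norm)
  have cont: "isCont N x" for x
    using continuous_on_equivalent_norm[OF N] by (simp add: continuous_on_eq_continuous_at)
  have 2: "(\<lambda>i. \<integral>x. N (g i x) \<partial>M) \<longlonglongrightarrow> (\<integral>x. N (f x) \<partial>M)"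
  proof (rule integral_dominated_convergence[where w = "\<lambda>x. c * (2 * norm (f x))"])
    show "AE x in M. (\<lambda>i. N (g i x)) \<longlonglongrightarrow> N (f x)"
      by (intro AE_I2 isCont_tendsto_compose[OF cont] g(2))
    show "AE x in M. norm (N (g i x)) \<le> c * (2 * norm (f x))" for i
    proof (rule AE_I2)
      fix x assume "x \<in> space M"
      then have "c * norm (g i x) \<le> c * (2 * norm (f x))"
        using g(3)[of x i] c(1) by (intro mult_left_mono) (auto simp: dist_norm)
      then show "norm (N (g i x)) \<le> c * (2 * norm (f x))"
        using c(2)[of "g i x"] Nn(1)[of "g i x"] by simp
    qed
  qed (use i2 in auto)
  have 3: "(\<lambda>i. N (\<integral>x. g i x \<partial>M)) \<longlonglongrightarrow> N (\<integral>x. f x \<partial>M)"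
    by (rule isCont_tendsto_compose[OF cont 1])
  show ?thesis by (rule LIMSEQ_le[OF 3 2]) (use simple[OF g(1)] in auto)
qed

text \<open>If \<open>N V > W\<close> on a set of positive measure, then by separability some part
  of it of positive measure has \<open>V\<close> close to a constant \<open>c\<close> and
  \<open>W\<close> below a number that is smaller than \<open>N c\<close>, and the integrals over
  that part contradict the hypothesis. This argument replaces the usual appeal to countably many
  supporting functionals.\<close>

lemma equivalent_norm_AE_le_if_set_integrals_le:
  fixes V :: "'a \<Rightarrow> 'b::{banach, second_countable_topology}"
  assumes N: "equivalent_norm N" and G: "subalgebra M G"
    and V: "V \<in> borel_measurable G" "integrable M V"
    and W: "W \<in> borel_measurable G" "integrable M W"
    and le: "\<And>B. B \<in> sets G \<Longrightarrow> N (LINT x:B|M. V x) \<le> (LINT x:B|M. W x)"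
  shows "AE x in M. N (V x) \<le> W x"
proof -
  note Nn = equivalent_normD[OF N]
  obtain C where C: "C \<ge> 1" "\<And>x. N x \<le> C * norm x"
    using equivalent_norm_bounds[OF N] by metis
  obtain D :: "'b set" where D: "countable D" "\<And>X. open X \<Longrightarrow> X \<noteq> {} \<Longrightarrow> \<exists>d\<in>D. d \<in> X"
    using countable_dense_setE by metis
  have [measurable]: "V \<in> borel_measurable G" "W \<in> borel_measurable G" by (rule V W)+
  note equivalent_norm_measurable[OF N, measurable]
  \<comment> \<open>Countably many sets \<open>B (c, a, \<delta>)\<close> cover the exceptional
    set: there \<open>N V\<close> is at least \<open>N c - \<delta>\<close>, which exceeds
    \<open>a\<close>, whereas \<open>W\<close> is below \<open>a\<close>.\<close>
  define T where "T = {t \<in> D \<times> \<rat> \<times> \<rat>. case t of (c, a, \<delta>) \<Rightarrow> N c - \<delta> > (a::real)}"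
  define B where "B t = (case t of (c, a, \<delta>) \<Rightarrow> {x \<in> space G. N (V x - c) < \<delta> \<and> W x < (a::real)})" for t
  have Ts: "T \<subseteq> D \<times> \<rat> \<times> \<rat>" by (auto simp: T_def)
  have cT: "countable T"
    using D(1) countable_rat by (intro countable_subset[OF Ts] countable_SIGMA) auto
  have null: "B t \<in> null_sets M" if t: "t \<in> T" for t
  proof -
    obtain c a \<delta> where t': "t = (c, a, \<delta>)" by (cases t)
    have gap: "N c - \<delta> > a" using t by (simp add: T_def t')
    have BG: "B t \<in> sets G" unfolding B_def t' by simp
    then have BM[measurable]: "B t \<in> sets M" using G by (auto simp: subalgebra_def)
    have iV: "integrable M (\<lambda>x. indicator (B t) x *\<^sub>R V x)" using V(2) BM by (rule integrable_mult_indicator[rotated])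
    have iW: "integrable M (\<lambda>x. indicator (B t) x *\<^sub>R W x)" using W(2) BM by (rule integrable_mult_indicator[rotated])
    have ic: "integrable M (\<lambda>x. indicator (B t) x *\<^sub>R c)" by (rule indicator_scaleR_integral[OF BM])
    define P where "P = measure M (B t)"
    have eq: "P *\<^sub>R c = (LINT x:B t|M. V x) - (\<integral>x. indicator (B t) x *\<^sub>R (V x - c) \<partial>M)"
    proof -
      have "(\<integral>x. indicator (B t) x *\<^sub>R (V x - c) \<partial>M)
          = (\<integral>x. indicator (B t) x *\<^sub>R V x \<partial>M) - (\<integral>x. indicator (B t) x *\<^sub>R c \<partial>M)"
        unfolding scaleR_diff_right using iV ic by (rule Bochner_Integration.integral_diff)
      then show ?thesis unfolding indicator_scaleR_integral(2)[OF BM]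
        by (simp add: set_lebesgue_integral_def P_def algebra_simps)
    qed
    have "P * N c = N (P *\<^sub>R c)" by (simp add: Nn P_def)
    also have "\<dots> \<le> N (LINT x:B t|M. V x) + N (\<integral>x. indicator (B t) x *\<^sub>R (V x - c) \<partial>M)"
      unfolding eq by (rule equivalent_norm_diff[OF N])
    also have "N (LINT x:B t|M. V x) \<le> (LINT x:B t|M. W x)" by (rule le[OF BG])
    also have "(LINT x:B t|M. W x) \<le> (\<integral>x. indicator (B t) x *\<^sub>R a \<partial>M)"
      unfolding set_lebesgue_integral_def
      by (intro integral_mono[OF iW indicator_scaleR_integral(1)[OF BM]]) (auto simp: indicator_def B_def t')
    also have "\<dots> = P * a" by (subst indicator_scaleR_integral[OF BM]) (simp add: P_def)
    also have "N (\<integral>x. indicator (B t) x *\<^sub>R (V x - c) \<partial>M) \<le> (\<integral>x. N (indicator (B t) x *\<^sub>R (V x - c)) \<partial>M)"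
      using iV ic by (intro equivalent_norm_integral_le[OF N]) (auto simp: scaleR_diff_right)
    also have "\<dots> \<le> (\<integral>x. indicator (B t) x *\<^sub>R \<delta> \<partial>M)"
    proof (rule integral_mono)
      show "integrable M (\<lambda>x. N (indicator (B t) x *\<^sub>R (V x - c)))"
        using iV ic by (intro equivalent_norm_integrable[OF N]) (auto simp: scaleR_diff_right)
      show "integrable M (\<lambda>x. indicator (B t) x *\<^sub>R \<delta>)" by (rule indicator_scaleR_integral[OF BM])
      show "N (indicator (B t) x *\<^sub>R (V x - c)) \<le> indicator (B t) x *\<^sub>R \<delta>" for x
        by (auto simp: indicator_def B_def t' equivalent_norm_zero[OF N])
    qed
    also have "\<dots> = P * \<delta>" by (subst indicator_scaleR_integral[OF BM]) (simp add: P_def)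
    finally have "P * (N c - \<delta> - a) \<le> 0" by (simp add: algebra_simps)
    then have "P \<le> 0" using gap by (simp add: mult_le_0_iff)
    then have "P = 0" by (simp add: P_def measure_le_0_iff)
    then show ?thesis using BM by (simp add: P_def null_sets_def emeasure_eq_measure)
  qed
  have "AE x in M. \<forall>t\<in>T. x \<notin> B t"
    using null by (subst AE_ball_countable[OF cT]) (auto intro: AE_not_in)
  then show ?thesis
  proof (rule AE_mp[OF _ AE_I2], intro impI)
    fix x assume x: "x \<in> space M" and notB: "\<forall>t\<in>T. x \<notin> B t"
    show "N (V x) \<le> W x"
    proof (rule ccontr)
      assume "\<not> N (V x) \<le> W x"
      define g where "g = N (V x) - W x"
      have g: "g > 0" using \<open>\<not> N (V x) \<le> W x\<close> by (simp add: g_def)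
      obtain a where a: "a \<in> \<rat>" "W x < a" "a < W x + g/4"
        using Rats_dense_in_real[of "W x" "W x + g/4"] g by auto
      obtain \<delta> where \<delta>: "\<delta> \<in> \<rat>" "0 < \<delta>" "\<delta> < g/4"
        using Rats_dense_in_real[of 0 "g/4"] g by auto
      obtain c where c: "c \<in> D" "c \<in> ball (V x) (\<delta> / C)"
        using D(2)[of "ball (V x) (\<delta> / C)"] \<delta>(2) C(1) by (auto simp: divide_le_0_iff)
      have "N (V x - c) \<le> C * norm (V x - c)" by (rule C)
      also have "\<dots> < \<delta>" using c(2) C by (simp add: dist_norm field_simps)
      finally have close: "N (V x - c) < \<delta>" .
      have "N (V x) \<le> N (V x - c) + N c" using Nn(4)[of "V x - c" c] by simp
      then have "N c - \<delta> > a" using close a \<delta> by (simp add: g_def field_simps)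
      then have "(c, a, \<delta>) \<in> T" using c a \<delta> by (simp add: T_def)
      moreover have "x \<in> B (c, a, \<delta>)" using close a x G by (auto simp: B_def subalgebra_def)
      ultimately show False using notB by blast
    qed
  qed
qed

lemma subalgebra_sigma_finite:
  assumes "subalgebra M G"
  shows "sigma_finite_subalgebra M G"
  using assms by (intro finite_measure_subalgebra_is_sigma_finite finite_measure_subalgebra.intro)
    (auto simp: finite_measure_subalgebra_axioms_def finite_measure_axioms)

lemma is_cond_exp_norm_le:
  fixes V Z :: "'a \<Rightarrow> 'b::{banach, second_countable_topology}"
  assumes N: "equivalent_norm N" and G: "subalgebra M G" and ce: "is_cond_exp M G Z V"
  shows "AE x in M. N (V x) \<le> real_cond_exp M G (\<lambda>x. N (Z x)) x"
proof -
  interpret sigma_finite_subalgebra M G by (rule subalgebra_sigma_finite[OF G])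
  have Z: "integrable M Z" and V: "integrable M V" "V \<in> borel_measurable G"
    and eq: "\<And>B. B \<in> sets G \<Longrightarrow> (LINT x:B|M. Z x) = (LINT x:B|M. V x)"
    using ce by (auto simp: is_cond_exp_def)
  have NZ: "integrable M (\<lambda>x. N (Z x))" by (rule equivalent_norm_integrable[OF N Z])
  show ?thesis
  proof (rule equivalent_norm_AE_le_if_set_integrals_le[OF N G V(2,1)])
    fix B assume B: "B \<in> sets G"
    have BM: "B \<in> sets M" using B G by (auto simp: subalgebra_def)
    have "N (LINT x:B|M. V x) = N (\<integral>x. indicator B x *\<^sub>R Z x \<partial>M)"
      using eq[OF B] by (simp add: set_lebesgue_integral_def)
    also have "\<dots> \<le> (\<integral>x. N (indicator B x *\<^sub>R Z x) \<partial>M)"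
      by (intro equivalent_norm_integral_le[OF N] integrable_mult_indicator[OF BM Z])
    also have "\<dots> = (LINT x:B|M. N (Z x))"
      unfolding set_lebesgue_integral_def by (simp add: equivalent_normD[OF N])
    also have "\<dots> = (LINT x:B|M. real_cond_exp M G (\<lambda>x. N (Z x)) x)"
      by (rule real_cond_exp_intA[OF NZ B])
    finally show "N (LINT x:B|M. V x) \<le> (LINT x:B|M. real_cond_exp M G (\<lambda>x. N (Z x)) x)" .
  qed (auto simp: real_cond_exp_int(1)[OF NZ])
qed

text \<open>The pointwise bound \<open>N V \<le> E[N Z | G]\<close> reduces Jensen's inequality
  for the convex function \<open>N powr q\<close> to the real-valued one.\<close>

lemma is_cond_exp_powr_contraction:
  fixes V Z :: "'a \<Rightarrow> 'b::{banach, second_countable_topology}"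
  assumes N: "equivalent_norm N" and G: "subalgebra M G" and ce: "is_cond_exp M G Z V"
    and q: "1 \<le> q" and Zq: "integrable M (\<lambda>x. N (Z x) powr q)"
  shows "integrable M (\<lambda>x. N (V x) powr q)"
    and "(\<integral>x. N (V x) powr q \<partial>M) \<le> (\<integral>x. N (Z x) powr q \<partial>M)"
proof -
  interpret sigma_finite_subalgebra M G by (rule subalgebra_sigma_finite[OF G])
  note equivalent_norm_measurable[OF N, measurable]
  note Nn = equivalent_normD[OF N]
  have Z: "integrable M Z" and V: "integrable M V" "V \<in> borel_measurable G"
    using ce by (auto simp: is_cond_exp_def)
  have Vm[measurable]: "V \<in> borel_measurable M" using V by auto
  have NZ: "integrable M (\<lambda>x. N (Z x))" by (rule equivalent_norm_integrable[OF N Z])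
  define W where "W = real_cond_exp M G (\<lambda>x. N (Z x))"
  define U where "U = real_cond_exp M G (\<lambda>x. N (Z x) powr q)"
  have "AE x in M. \<bar>W x\<bar> powr q \<le> real_cond_exp M G (\<lambda>x. \<bar>N (Z x)\<bar> powr q) x"
    unfolding W_def using Zq Nn(1)
    by (intro real_cond_exp_jensens_inequality(2)[where I = UNIV] NZ convex_on_abs_powr q) auto
  moreover have "AE x in M. N (V x) \<le> W x"
    unfolding W_def by (rule is_cond_exp_norm_le[OF N G ce])
  ultimately have le: "AE x in M. N (V x) powr q \<le> U x"
  proof eventually_elim
    case (elim x)
    have "N (V x) powr q \<le> \<bar>W x\<bar> powr q"
      using elim q Nn(1) by (intro powr_mono2) auto
    then show ?case using elim Nn(1) by (simp add: U_def)
  qed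
  have U: "integrable M U" "(\<integral>x. U x \<partial>M) = (\<integral>x. N (Z x) powr q \<partial>M)"
    unfolding U_def using real_cond_exp_int[OF Zq] by auto
  show 1: "integrable M (\<lambda>x. N (V x) powr q)"
    using le U(1) by (intro Bochner_Integration.integrable_bound[OF U(1)]) (auto elim!: eventually_mono)
  show "(\<integral>x. N (V x) powr q \<partial>M) \<le> (\<integral>x. N (Z x) powr q \<partial>M)"
    unfolding U(2)[symmetric] by (rule integral_mono_AE[OF 1 U(1) le])
qed

end

section \<open>Martingale and orthomartingale inequalities in \<open>L\<^sup>q\<close>\<close>

definition Lq_norm :: "'a measure \<Rightarrow> ('b \<Rightarrow> real) \<Rightarrow> real \<Rightarrow> ('a \<Rightarrow> 'b) \<Rightarrow> real" where
  "Lq_norm M N q f = (\<integral>x. N (f x) powr q \<partial>M) powr (1 / q)"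

text \<open>The orthomartingale property in the form that complete commutation gives it: the
  conditional expectation vanishes given every \<open>F j\<close> with \<open>i \<le> j\<close>
  false, and not just given the immediate predecessors of \<open>i\<close>.\<close>

definition orth_differences ::
    "'a measure \<Rightarrow> (int ^ 'd \<Rightarrow> 'a measure) \<Rightarrow> (int ^ 'd \<Rightarrow> 'a \<Rightarrow> 'b::{banach, second_countable_topology}) \<Rightarrow> bool" where
  "orth_differences M F Y \<longleftrightarrow>
     (\<forall>i. Y i \<in> borel_measurable (F i)) \<and>
     (\<forall>i j. \<not> i \<le> j \<longrightarrow> is_cond_exp M (F j) (Y i) (\<lambda>_. 0))"

text \<open>Minkowski's inequality in \<open>L\<^sup>u\<close>, obtained from the convexity of the
  power applied to the normalised functions \<open>a / \<alpha>\<close> and \<open>b /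
  \<beta>\<close>, with weights proportional to the norms \<open>\<alpha>\<close> and
  \<open>\<beta>\<close>.\<close>

lemma powr_integral_add_le:
  fixes a b :: "'a \<Rightarrow> real"
  assumes u: "1 \<le> u" and a: "\<And>x. 0 \<le> a x" and b: "\<And>x. 0 \<le> b x"
    and am[measurable]: "a \<in> borel_measurable M" and bm[measurable]: "b \<in> borel_measurable M"
    and ai: "integrable M (\<lambda>x. a x powr u)" and bi: "integrable M (\<lambda>x. b x powr u)"
  shows "integrable M (\<lambda>x. (a x + b x) powr u)"
    and "(\<integral>x. (a x + b x) powr u \<partial>M) \<le>
      ((\<integral>x. a x powr u \<partial>M) powr (1 / u) + (\<integral>x. b x powr u \<partial>M) powr (1 / u)) powr u"
proof -
  have int: "integrable M (\<lambda>x. 2 powr u * (a x powr u + b x powr u))" using ai bi by auto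
  show i: "integrable M (\<lambda>x. (a x + b x) powr u)"
    using powr_add_le[OF a b u] by (intro Bochner_Integration.integrable_bound[OF int]) auto
  define \<alpha> where "\<alpha> = (\<integral>x. a x powr u \<partial>M) powr (1 / u)"
  define \<beta> where "\<beta> = (\<integral>x. b x powr u \<partial>M) powr (1 / u)"
  have A: "(\<integral>x. a x powr u \<partial>M) = \<alpha> powr u" and B: "(\<integral>x. b x powr u \<partial>M) = \<beta> powr u"
    using u by (auto simp: \<alpha>_def \<beta>_def powr_powr)
  have nn: "0 \<le> \<alpha>" "0 \<le> \<beta>" by (auto simp: \<alpha>_def \<beta>_def)
  have zero: "AE x in M. f x = 0" if "(\<integral>x. f x powr u \<partial>M) = 0" "integrable M (\<lambda>x. f x powr u)" for f :: "'a \<Rightarrow> real"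
    using integral_nonneg_eq_0_iff_AE[OF that(2)] that(1) by auto
  consider "\<alpha> = 0" | "\<beta> = 0" | "\<alpha> > 0" "\<beta> > 0" using nn by linarith
  then have "(\<integral>x. (a x + b x) powr u \<partial>M) \<le> (\<alpha> + \<beta>) powr u"
  proof cases
    case 1
    then have "AE x in M. a x = 0" using A u by (intro zero ai) simp
    then have "(\<integral>x. (a x + b x) powr u \<partial>M) = (\<integral>x. b x powr u \<partial>M)"
      by (intro integral_cong_AE) auto
    then show ?thesis using 1 B by simp
  next
    case 2
    then have "AE x in M. b x = 0" using B u by (intro zero bi) simp
    then have "(\<integral>x. (a x + b x) powr u \<partial>M) = (\<integral>x. a x powr u \<partial>M)"
      by (intro integral_cong_AE) auto
    then show ?thesis using 2 A by simp
  next
    case 3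
    define t where "t = \<beta> / (\<alpha> + \<beta>)"
    have t: "0 \<le> t" "t \<le> 1" "1 - t = \<alpha> / (\<alpha> + \<beta>)" using 3 by (auto simp: t_def field_simps)
    have pt: "(a x + b x) powr u \<le>
        (\<alpha> + \<beta>) powr u * ((1 - t) / \<alpha> powr u * a x powr u + t / \<beta> powr u * b x powr u)" for x
    proof -
      have "a x + b x = (\<alpha> + \<beta>) * ((1 - t) * (a x / \<alpha>) + t * (b x / \<beta>))"
      proof -
        have "(\<alpha> + \<beta>) * ((1 - t) * (a x / \<alpha>)) = a x" "(\<alpha> + \<beta>) * (t * (b x / \<beta>)) = b x"
          unfolding t(3) using 3 by (auto simp: t_def)
        then show ?thesis by (simp add: distrib_left)
      qed
      then have "(a x + b x) powr u = (\<alpha> + \<beta>) powr u * ((1 - t) * (a x / \<alpha>) + t * (b x / \<beta>)) powr u"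
        using t 3 a b by (simp add: powr_mult)
      also have "\<dots> \<le> (\<alpha> + \<beta>) powr u * ((1 - t) * (a x / \<alpha>) powr u + t * (b x / \<beta>) powr u)"
        using convex_onD[OF convex_on_powr_nonneg[OF u], of t "a x / \<alpha>" "b x / \<beta>"] t a b 3
        by (intro mult_left_mono) auto
      finally show ?thesis using a b 3 by (simp add: powr_divide)
    qed
    have "(\<integral>x. (a x + b x) powr u \<partial>M) \<le>
        (\<integral>x. (\<alpha> + \<beta>) powr u * ((1 - t) / \<alpha> powr u * a x powr u + t / \<beta> powr u * b x powr u) \<partial>M)"
      using pt ai bi i by (intro integral_mono) auto
    also have "\<dots> = (\<alpha> + \<beta>) powr u * ((1 - t) / \<alpha> powr u * \<alpha> powr u + t / \<beta> powr u * \<beta> powr u)"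
      using ai bi A B by simp
    also have "\<dots> = (\<alpha> + \<beta>) powr u" using 3 by simp
    finally show ?thesis .
  qed
  then show "(\<integral>x. (a x + b x) powr u \<partial>M) \<le>
      ((\<integral>x. a x powr u \<partial>M) powr (1 / u) + (\<integral>x. b x powr u \<partial>M) powr (1 / u)) powr u"
    by (simp add: \<alpha>_def \<beta>_def)
qed

lemma is_cond_exp_add:
  assumes "subalgebra M G" "is_cond_exp M G X V" "is_cond_exp M G Y W"
  shows "is_cond_exp M G (\<lambda>x. X x + Y x) (\<lambda>x. V x + W x)"
proof -
  have "set_integrable M B f" if "integrable M f" "B \<in> sets G" for B and f :: "'a \<Rightarrow> 'b"
    unfolding set_integrable_def using that assms(1) by (intro integrable_mult_indicator) (auto simp: subalgebra_def)
  then show ?thesis using assms(2,3) by (auto simp: is_cond_exp_def set_integral_add)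
qed

lemma is_cond_exp_linear:
  assumes T: "bounded_linear T" and G: "subalgebra M G" and ce: "is_cond_exp M G X V"
  shows "is_cond_exp M G (\<lambda>x. T (X x)) (\<lambda>x. T (V x))"
proof -
  have X: "integrable M X" and V: "integrable M V" "V \<in> borel_measurable G"
    and eq: "\<And>B. B \<in> sets G \<Longrightarrow> (LINT x:B|M. X x) = (LINT x:B|M. V x)"
    using ce by (auto simp: is_cond_exp_def)
  have pull: "(LINT x:B|M. T (f x)) = T (LINT x:B|M. f x)" if f: "integrable M f" and B: "B \<in> sets G" for f B
  proof -
    have "integrable M (\<lambda>x. indicator B x *\<^sub>R f x)"
      using f B G by (intro integrable_mult_indicator) (auto simp: subalgebra_def)
    from integral_bounded_linear[OF T this] show ?thesis
      by (simp add: set_lebesgue_integral_def linear_cmul[OF bounded_linear.linear[OF T]])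
  qed
  have "T \<in> borel_measurable borel"
    by (intro borel_measurable_continuous_onI linear_continuous_on T)
  then have "(\<lambda>x. T (V x)) \<in> borel_measurable G"
    using measurable_compose[OF V(2)] by blast
  then show ?thesis
    unfolding is_cond_exp_def
    using X V eq by (auto intro: integrable_bounded_linear[OF T] simp: pull)
qed

lemma is_cond_exp_sum:
  assumes G: "subalgebra M G" and ce: "\<And>k. k \<in> T \<Longrightarrow> is_cond_exp M G (X k) (V k)"
  shows "is_cond_exp M G (\<lambda>x. \<Sum>k\<in>T. X k x) (\<lambda>x. \<Sum>k\<in>T. V k x)"
  using ce
proof (induction T rule: infinite_finite_induct)
  case (insert k T)
  then show ?case using is_cond_exp_add[OF G, of "X k" "V k"] by simp
qed (auto simp: is_cond_exp_def)

lemma is_cond_exp_self: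
  assumes "integrable M X" "X \<in> borel_measurable G"
  shows "is_cond_exp M G X X"
  using assms by (auto simp: is_cond_exp_def)

context prob_space
begin

lemma integrable_if_powr_integrable:
  fixes f :: "'a \<Rightarrow> 'b::{banach, second_countable_topology}"
  assumes N: "equivalent_norm N" and q: "1 \<le> q"
    and f[measurable]: "f \<in> borel_measurable M" and fq: "integrable M (\<lambda>x. N (f x) powr q)"
  shows "integrable M f"
proof -
  obtain c where c: "c \<ge> 1" "\<And>x. norm x \<le> c * N x"
    using equivalent_norm_bounds[OF N] by metis
  have i: "integrable M (\<lambda>x. c * (1 + N (f x) powr q))" using fq by auto
  show ?thesis
  proof (rule Bochner_Integration.integrable_bound[OF i f], rule AE_I2)
    fix x
    have "N (f x) \<le> 1 + N (f x) powr q"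
    proof (cases "N (f x) \<le> 1")
      case False
      then have "N (f x) powr 1 \<le> N (f x) powr q" using q by (intro powr_mono) auto
      then show ?thesis using False by simp
    qed (use powr_ge_zero[of "N (f x)" q] in linarith)
    then have "c * N (f x) \<le> c * (1 + N (f x) powr q)" using c by (intro mult_left_mono) auto
    then show "norm (f x) \<le> norm (c * (1 + N (f x) powr q))" using c(2)[of "f x"] by simp
  qed
qed

lemma powr_integrable_add:
  fixes f g :: "'a \<Rightarrow> 'b::{banach, second_countable_topology}"
  assumes N: "equivalent_norm N" and q: "1 \<le> q"
    and [measurable]: "f \<in> borel_measurable M" "g \<in> borel_measurable M"
    and fq: "integrable M (\<lambda>x. N (f x) powr q)" and gq: "integrable M (\<lambda>x. N (g x) powr q)"
  shows "integrable M (\<lambda>x. N (f x + g x) powr q)"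
proof -
  note equivalent_norm_measurable[OF N, measurable]
  have int: "integrable M (\<lambda>x. 2 powr q * (N (f x) powr q + N (g x) powr q))" using fq gq by auto
  have "N (f x + g x) powr q \<le> 2 powr q * (N (f x) powr q + N (g x) powr q)" for x
    using powr_add_le[OF equivalent_normD(1)[OF N] equivalent_normD(1)[OF N] q]
      powr_mono2[OF _ equivalent_normD(1)[OF N] equivalent_normD(4)[OF N], of q] q
    by (meson dual_order.trans order_trans[OF zero_le_one])
  then show ?thesis by (intro Bochner_Integration.integrable_bound[OF int]) auto
qed

lemma powr_integrable_sum:
  fixes f :: "'i \<Rightarrow> 'a \<Rightarrow> 'b::{banach, second_countable_topology}"
  assumes N: "equivalent_norm N" and q: "1 \<le> q"
    and "\<And>i. i \<in> T \<Longrightarrow> f i \<in> borel_measurable M" "\<And>i. i \<in> T \<Longrightarrow> integrable M (\<lambda>x. N (f i x) powr q)"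
  shows "integrable M (\<lambda>x. N (\<Sum>i\<in>T. f i x) powr q)"
  using assms(3,4)
proof (induction T rule: infinite_finite_induct)
  case (insert i T)
  then show ?case using powr_integrable_add[OF N q, of "f i" "\<lambda>x. \<Sum>i\<in>T. f i x"] by simp
qed (use q in \<open>simp_all add: equivalent_norm_zero[OF N]\<close>)

text \<open>Write \<open>u = q / p\<close>, \<open>m = \<parallel>S\<parallel>^p\<close> and
  \<open>\<delta> = \<parallel>D\<parallel>^p\<close>. Since \<open>S\<close> is the conditional
  expectation of \<open>S - D\<close>, Jensen gives \<open>\<parallel>S\<parallel> \<le>
  \<parallel>S - D\<parallel>\<close>. The two-point inequality and Minkowski therefore yield
  \<open>\<parallel>S + D\<parallel>^q + m^u \<le> 2 (m + K \<delta>)^u\<close>, and by convexity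
  the right-hand side is at most \<open>m^u + (m + 2 K \<delta>)^u\<close>.\<close>

lemma Lq_norm_martingale_step:
  fixes S D :: "'a \<Rightarrow> 'b::{banach, second_countable_topology}"
  assumes N: "equivalent_norm N" and tp: "smooth_two_point N p q K" and K: "0 \<le> K"
    and p: "1 \<le> p" and q: "p \<le> q"
    and G: "subalgebra M G" and S: "S \<in> borel_measurable G" and Sq: "integrable M (\<lambda>x. N (S x) powr q)"
    and D: "is_cond_exp M G D (\<lambda>_. 0)" and Dq: "integrable M (\<lambda>x. N (D x) powr q)"
  shows "Lq_norm M N q (\<lambda>x. S x + D x) powr p \<le> Lq_norm M N q S powr p + 2 * K * Lq_norm M N q D powr p"
proof -
  note equivalent_norm_measurable[OF N, measurable]
  note Nn = equivalent_normD[OF N]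
  have q1: "1 \<le> q" using p q by simp
  define u where "u = q / p"
  have u: "1 \<le> u" using p q by (simp add: u_def)
  have [measurable]: "S \<in> borel_measurable M" using measurable_from_subalg[OF G S] .
  have Di: "integrable M D" using D by (simp add: is_cond_exp_def)
  have [measurable]: "D \<in> borel_measurable M" using Di by auto
  have Si: "integrable M S" by (rule integrable_if_powr_integrable[OF N q1 _ Sq]) simp
  define I where "I f = (\<integral>x. N (f x) powr q \<partial>M)" for f :: "'a \<Rightarrow> 'b"
  define m where "m = I S powr (1 / u)"
  define \<delta> where "\<delta> = I D powr (1 / u)"
  have I0: "0 \<le> I f" for f by (simp add: I_def)
  have mu: "m powr u = I S" using u I0[of S] by (simp add: m_def powr_powr)
  have toI: "Lq_norm M N q f powr p = I f powr (1 / u)" for f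
    using p q by (simp add: Lq_norm_def I_def powr_powr u_def)
  have m0: "m \<ge> 0" and d0: "\<delta> \<ge> 0" by (auto simp: m_def \<delta>_def)
  have mD: "integrable M (\<lambda>x. N (- D x) powr q)" using Dq by (simp add: equivalent_norm_minus[OF N])
  have ip: "integrable M (\<lambda>x. N (S x + D x) powr q)"
    by (intro powr_integrable_add[OF N q1] Sq Dq) auto
  have im: "integrable M (\<lambda>x. N (S x - D x) powr q)"
    using powr_integrable_add[OF N q1 _ _ Sq mD] by simp
  have "is_cond_exp M G (\<lambda>x. S x + - D x) (\<lambda>x. S x + - 0)"
    by (intro is_cond_exp_add[OF G] is_cond_exp_self Si S
        is_cond_exp_linear[OF bounded_linear_minus[OF bounded_linear_ident] G D])
  then have "is_cond_exp M G (\<lambda>x. S x - D x) S" by simp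
  then have "I S \<le> I (\<lambda>x. S x - D x)"
    unfolding I_def by (rule is_cond_exp_powr_contraction(2)[OF N G _ q1 im])
  then have "I (\<lambda>x. S x + D x) + I S \<le> I (\<lambda>x. S x + D x) + I (\<lambda>x. S x - D x)" by simp
  also have "\<dots> = (\<integral>x. N (S x + D x) powr q + N (S x - D x) powr q \<partial>M)"
    unfolding I_def using ip im by simp
  also have "\<dots> \<le> (\<integral>x. 2 * (N (S x) powr p + K * N (D x) powr p) powr u \<partial>M)"
  proof (rule integral_mono)
    show "integrable M (\<lambda>x. 2 * (N (S x) powr p + K * N (D x) powr p) powr u)"
      using u Sq Dq K p by (intro integrable_mult_right powr_integral_add_le(1)) (auto simp: powr_mult powr_powr u_def)
  qed (use tp ip im in \<open>auto simp: smooth_two_point_def u_def\<close>)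
  also have "\<dots> = 2 * (\<integral>x. (N (S x) powr p + K * N (D x) powr p) powr u \<partial>M)" by simp
  also have "\<dots> \<le> 2 * ((\<integral>x. (N (S x) powr p) powr u \<partial>M) powr (1/u)
      + (\<integral>x. (K * N (D x) powr p) powr u \<partial>M) powr (1/u)) powr u"
    using u Sq Dq K p by (intro mult_left_mono powr_integral_add_le(2)) (auto simp: powr_mult powr_powr u_def)
  also have "(\<integral>x. (N (S x) powr p) powr u \<partial>M) powr (1/u) = m"
    using p by (simp add: m_def I_def powr_powr u_def)
  also have "(\<integral>x. (K * N (D x) powr p) powr u \<partial>M) powr (1/u) = K * \<delta>"
  proof -
    have "(\<integral>x. (K * N (D x) powr p) powr u \<partial>M) = K powr u * I D"
      using p K by (simp add: I_def powr_powr powr_mult u_def)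
    moreover have "(K powr u * I D) powr (1/u) = K * \<delta>"
      using K u I0[of D] by (simp add: powr_mult powr_powr \<delta>_def)
    ultimately show ?thesis by simp
  qed
  also have "2 * (m + K * \<delta>) powr u \<le> m powr u + (m + 2 * (K * \<delta>)) powr u"
    using m0 d0 K u by (intro two_powr_add_le) auto
  finally have "I (\<lambda>x. S x + D x) \<le> (m + 2 * (K * \<delta>)) powr u" by (simp add: mu)
  then have "I (\<lambda>x. S x + D x) powr (1/u) \<le> ((m + 2 * (K * \<delta>)) powr u) powr (1/u)"
    using u I0 by (intro powr_mono2) auto
  also have "\<dots> = m + 2 * (K * \<delta>)" using u m0 d0 K by (simp add: powr_powr)
  finally show ?thesis by (simp add: toI m_def \<delta>_def)
qed

lemma Lq_norm_martingale_sum: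
  fixes D :: "int \<Rightarrow> 'a \<Rightarrow> 'b::{banach, second_countable_topology}"
  assumes N: "equivalent_norm N" and tp: "smooth_two_point N p q K" and K: "1 \<le> K"
    and p: "1 \<le> p" and q: "p \<le> q" and T: "finite T"
    and Dm: "\<And>k. k \<in> T \<Longrightarrow> D k \<in> borel_measurable M"
    and Dq: "\<And>k. k \<in> T \<Longrightarrow> integrable M (\<lambda>x. N (D k x) powr q)"
    and G: "\<And>k. k \<in> T \<Longrightarrow> subalgebra M (G k)"
    and DG: "\<And>k k'. k \<in> T \<Longrightarrow> k' \<in> T \<Longrightarrow> k' < k \<Longrightarrow> D k' \<in> borel_measurable (G k)"
    and orth: "\<And>k. k \<in> T \<Longrightarrow> is_cond_exp M (G k) (D k) (\<lambda>_. 0)"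
  shows "Lq_norm M N q (\<lambda>x. \<Sum>k\<in>T. D k x) powr p \<le> 2 * K * (\<Sum>k\<in>T. Lq_norm M N q (D k) powr p)"
  using T Dm Dq G DG orth
proof (induction T rule: finite_linorder_max_induct)
  case empty
  then show ?case using p q by (simp add: Lq_norm_def equivalent_norm_zero[OF N])
next
  case (insert b T)
  have q1: "1 \<le> q" using p q by simp
  have "b \<notin> T" using insert.hyps(2) by auto
  have "Lq_norm M N q (\<lambda>x. \<Sum>k\<in>insert b T. D k x) powr p
      = Lq_norm M N q (\<lambda>x. (\<Sum>k\<in>T. D k x) + D b x) powr p"
    using insert.hyps(1) \<open>b \<notin> T\<close> by (simp add: add.commute)
  also have "\<dots> \<le> Lq_norm M N q (\<lambda>x. \<Sum>k\<in>T. D k x) powr p + 2 * K * Lq_norm M N q (D b) powr p"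
  proof (rule Lq_norm_martingale_step[OF N tp _ p q])
    show "subalgebra M (G b)" using insert.prems by simp
    show "(\<lambda>x. \<Sum>k\<in>T. D k x) \<in> borel_measurable (G b)"
      using insert.prems insert.hyps by (intro borel_measurable_sum) auto
    show "integrable M (\<lambda>x. N (\<Sum>k\<in>T. D k x) powr q)"
      using insert.prems by (intro powr_integrable_sum[OF N q1]) auto
  qed (use insert.prems K in auto)
  also have "Lq_norm M N q (\<lambda>x. \<Sum>k\<in>T. D k x) powr p \<le> 2 * K * (\<Sum>k\<in>T. Lq_norm M N q (D k) powr p)"
    using insert.prems by (intro insert.IH) auto
  finally show ?case using insert.hyps(1) \<open>b \<notin> T\<close> by (simp add: algebra_simps)
qed

text \<open>Induction over the set \<open>L\<close> of coordinates in which the indices may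
  differ. Grouping the indices by the value of a new coordinate \<open>l\<close> gives a
  martingale difference sequence in \<open>l\<close>, whose terms are orthomartingale sums over
  \<open>L\<close>. The inequality could not be applied along a linear order of all indices,
  because the \<open>\<sigma>\<close>-algebra generated by the earlier indices may already
  determine the next difference.\<close>

lemma Lq_norm_orth_sum_on_coordinates:
  fixes Y :: "int ^ 'd \<Rightarrow> 'a \<Rightarrow> 'b::{banach, second_countable_topology}"
  assumes N: "equivalent_norm N" and tp: "smooth_two_point N p q K" and K: "1 \<le> K"
    and p: "1 \<le> p" and q: "p \<le> q"
    and F: "\<And>i. subalgebra M (F i)" and mono: "\<And>i j. i \<le> j \<Longrightarrow> sets (F i) \<subseteq> sets (F j)"
    and Y: "orth_differences M F Y" and Yq: "\<And>i. integrable M (\<lambda>x. N (Y i x) powr q)"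
    and L: "finite (L :: 'd set)" and J: "finite J"
    and agree: "\<And>i j l. i \<in> J \<Longrightarrow> j \<in> J \<Longrightarrow> l \<notin> L \<Longrightarrow> i $ l = j $ l"
  shows "Lq_norm M N q (\<lambda>x. \<Sum>i\<in>J. Y i x) powr p \<le> (2 * K) ^ card L * (\<Sum>i\<in>J. Lq_norm M N q (Y i) powr p)"
  using L J agree
proof (induction L arbitrary: J rule: finite_induct)
  case empty
  have "\<And>i j. i \<in> J \<Longrightarrow> j \<in> J \<Longrightarrow> i = j" using empty(2) by (metis vec_eq_iff empty_iff)
  then have "J = {} \<or> (\<exists>i. J = {i})" by blast
  then show ?case
    using p q by (auto simp: Lq_norm_def equivalent_norm_zero[OF N])
next
  case (insert l L)
  have q1: "1 \<le> q" using p q by simp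
  have Ym: "Y i \<in> borel_measurable (F i)" for i using Y by (simp add: orth_differences_def)
  have YM: "Y i \<in> borel_measurable M" for i using measurable_from_subalg[OF F Ym] .
  have Yo: "is_cond_exp M (F j) (Y i) (\<lambda>_. 0)" if "\<not> i \<le> j" for i j
    using Y that by (simp add: orth_differences_def)
  define T where "T = (\<lambda>i. i $ l) ` J"
  define Jk where "Jk k = {i \<in> J. i $ l = k}" for k
  define D where "D k x = (\<Sum>i\<in>Jk k. Y i x)" for k x
  \<comment> \<open>A single index above all of \<open>J\<close> in the coordinates other than \<open>l\<close> suffices,
    so that no generated \<open>\<sigma>\<close>-algebra is needed.\<close>
  define top where "top k = (\<chi> m. if m = l then k - 1 else Max ((\<lambda>i. i $ m) ` J))" for k :: int
  have fin: "finite T" "finite (Jk k)" for k using insert.prems(1) by (auto simp: T_def Jk_def)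
  have split: "(\<Sum>i\<in>J. f i) = (\<Sum>k\<in>T. \<Sum>i\<in>Jk k. f i)" for f :: "int ^ 'd \<Rightarrow> 'c::comm_monoid_add"
    unfolding T_def Jk_def by (rule sum.image_gen[OF insert.prems(1)])
  have below: "i \<le> top k" if "i \<in> Jk k'" "k' < k" for i k k'
    using that insert.prems(1) by (auto simp: less_eq_vec_def top_def Jk_def intro!: Max_ge)
  have notbelow: "\<not> i \<le> top k" if "i \<in> Jk k" for i k
    using that by (auto simp: less_eq_vec_def top_def Jk_def intro!: exI[of _ l])
  have agreeJk: "i $ m = j $ m" if "i \<in> Jk k" "j \<in> Jk k" "m \<notin> L" for i j k m
    using that insert.prems(2)[of i j m] by (cases "m = l") (auto simp: Jk_def)
  have "Lq_norm M N q (\<lambda>x. \<Sum>i\<in>J. Y i x) powr p = Lq_norm M N q (\<lambda>x. \<Sum>k\<in>T. D k x) powr p"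
    by (simp add: split D_def)
  also have "\<dots> \<le> 2 * K * (\<Sum>k\<in>T. Lq_norm M N q (D k) powr p)"
  proof (rule Lq_norm_martingale_sum[OF N tp K p q fin(1), where G = "\<lambda>k. F (top k)"])
    fix k
    show "D k \<in> borel_measurable M" unfolding D_def using YM by (intro borel_measurable_sum) auto
    show "integrable M (\<lambda>x. N (D k x) powr q)"
      unfolding D_def using YM Yq by (intro powr_integrable_sum[OF N q1]) auto
    show "subalgebra M (F (top k))" by (rule F)
    show "D k' \<in> borel_measurable (F (top k))" if "k' < k" for k'
      unfolding D_def
    proof (rule borel_measurable_sum)
      fix i assume "i \<in> Jk k'"
      then have "sets (F i) \<subseteq> sets (F (top k))" using below that by (intro mono) auto
      then have "subalgebra (F (top k)) (F i)" using F[of i] F[of "top k"] by (simp add: subalgebra_def)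
      then show "Y i \<in> borel_measurable (F (top k))" using Ym by (rule measurable_from_subalg)
    qed
    show "is_cond_exp M (F (top k)) (D k) (\<lambda>_. 0)"
    proof -
      have "is_cond_exp M (F (top k)) (\<lambda>x. \<Sum>i\<in>Jk k. Y i x) (\<lambda>x. \<Sum>i\<in>Jk k. 0)"
        by (intro is_cond_exp_sum F Yo notbelow)
      then show ?thesis by (simp add: D_def[abs_def])
    qed
  qed
  also have "\<dots> \<le> 2 * K * (\<Sum>k\<in>T. (2 * K) ^ card L * (\<Sum>i\<in>Jk k. Lq_norm M N q (Y i) powr p))"
    unfolding D_def using K by (intro mult_left_mono sum_mono insert.IH fin agreeJk) auto
  also have "\<dots> = (2 * K) ^ card (insert l L) * (\<Sum>i\<in>J. Lq_norm M N q (Y i) powr p)"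
    using insert.hyps by (simp add: split sum_distrib_left mult.assoc)
  finally show ?case .
qed

lemma Lq_norm_orth_sum:
  fixes Y :: "int ^ 'd \<Rightarrow> 'a \<Rightarrow> 'b::{banach, second_countable_topology}"
  assumes "equivalent_norm N" "smooth_two_point N p q K" "1 \<le> K" "1 \<le> p" "p \<le> q"
    and "\<And>i. subalgebra M (F i)" "\<And>i j. i \<le> j \<Longrightarrow> sets (F i) \<subseteq> sets (F j)"
    and "orth_differences M F Y" "\<And>i. integrable M (\<lambda>x. N (Y i x) powr q)" "finite J"
  shows "Lq_norm M N q (\<lambda>x. \<Sum>i\<in>J. Y i x) powr p \<le> (2 * K) ^ CARD('d) * (\<Sum>i\<in>J. Lq_norm M N q (Y i) powr p)"
  using assms by (intro Lq_norm_orth_sum_on_coordinates) auto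

end

section \<open>Projections onto orthomartingale differences\<close>

text \<open>Conditional expectation of a function \<open>Z\<close> with finitely many values,
  assembled from real conditional expectations of the indicators of its level sets.\<close>

definition simple_cond_exp ::
    "'a measure \<Rightarrow> 'a measure \<Rightarrow> ('a \<Rightarrow> 'b::real_normed_vector) \<Rightarrow> 'a \<Rightarrow> 'b" where
  "simple_cond_exp M G Z x =
     (\<Sum>y\<in>Z ` space M. real_cond_exp M G (indicator (Z -` {y} \<inter> space M)) x *\<^sub>R y)"

definition lower :: "'d set \<Rightarrow> int ^ 'd \<Rightarrow> int ^ 'd" where
  "lower S i = (\<chi> l. if l \<in> S then i $ l - 1 else i $ l)"

text \<open>The product over all coordinates \<open>l\<close> of the differences \<open>E[\<cdot>
  | F i] - E[\<cdot> | F (i - axis l 1)]\<close>, expanded with the help of commutation.\<close>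

definition orth_projection ::
    "'a measure \<Rightarrow> (int ^ 'd \<Rightarrow> 'a measure) \<Rightarrow> int ^ 'd \<Rightarrow> ('a \<Rightarrow> 'b::real_normed_vector) \<Rightarrow> 'a \<Rightarrow> 'b" where
  "orth_projection M F i Z x =
     (\<Sum>S\<in>UNIV. (- 1) ^ card S *\<^sub>R simple_cond_exp M (F (lower S i)) Z x)"

lemma lower_le: "lower S i \<le> i"
  by (auto simp: lower_def less_eq_vec_def)

lemma lower_empty: "lower {} i = i"
  by (simp add: lower_def vec_eq_iff)

lemma lower_le_axis: "l \<in> S \<Longrightarrow> lower S i \<le> i - axis l 1"
  by (auto simp: lower_def less_eq_vec_def axis_def)

lemma sum_subsets_cancel:
  fixes g :: "'d::finite set \<Rightarrow> 'b::real_vector"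
  assumes "\<And>S. l \<notin> S \<Longrightarrow> g (insert l S) = - g S"
  shows "(\<Sum>S\<in>UNIV. g S) = 0"
proof -
  have "(\<Sum>S\<in>UNIV. g S) = (\<Sum>S\<in>{S. l \<notin> S}. g S) + (\<Sum>S\<in>{S. l \<in> S}. g S)"
    by (subst sum.union_disjoint[symmetric]) (auto intro!: sum.cong)
  also have "(\<Sum>S\<in>{S. l \<in> S}. g S) = (\<Sum>S\<in>{S. l \<notin> S}. g (insert l S))"
    by (rule sum.reindex_bij_witness[of _ "insert l" "\<lambda>S. S - {l}"]) (auto simp: insert_absorb)
  also have "\<dots> = - (\<Sum>S\<in>{S. l \<notin> S}. g S)" using assms by (simp add: sum_negf)
  finally show ?thesis by simp
qed

lemma card_sets: "real (card (UNIV :: 'd::finite set set)) = 2 ^ CARD('d)"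
  using card_Pow[of "UNIV :: 'd set"] by simp

lemma powr_sum_le:
  fixes a :: "'i \<Rightarrow> real"
  assumes T: "finite T" and a: "\<And>k. k \<in> T \<Longrightarrow> 0 \<le> a k" and q: "0 < q"
  shows "(\<Sum>k\<in>T. a k) powr q \<le> real (card T) powr q * (\<Sum>k\<in>T. a k powr q)"
proof (cases "T = {}")
  case False
  define m where "m = Max (a ` T)"
  have "m \<in> a ` T" unfolding m_def using False T by (intro Max_in) auto
  then obtain k where k: "k \<in> T" "a k = m" by blast
  have "(\<Sum>k\<in>T. a k) \<le> real (card T) * m"
    using sum_bounded_above[of T a m] T by (auto simp: m_def)
  then have "(\<Sum>k\<in>T. a k) powr q \<le> (real (card T) * m) powr q"
    using a q by (intro powr_mono2) (auto intro: sum_nonneg)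
  also have "\<dots> = real (card T) powr q * a k powr q" using a k by (simp add: powr_mult)
  also have "\<dots> \<le> real (card T) powr q * (\<Sum>k\<in>T. a k powr q)"
    using T k by (intro mult_left_mono member_le_sum) auto
  finally show ?thesis .
qed (use q in simp)

lemma is_cond_exp_cong:
  assumes "subalgebra M G" "\<And>x. x \<in> space M \<Longrightarrow> X x = X' x" "is_cond_exp M G X V"
  shows "is_cond_exp M G X' V"
proof -
  have "integrable M X' = integrable M X"
    using assms(2) by (intro Bochner_Integration.integrable_cong) auto
  moreover have "(LINT x:B|M. X' x) = (LINT x:B|M. X x)" for B
    unfolding set_lebesgue_integral_def
    using assms(2) by (intro Bochner_Integration.integral_cong) auto
  ultimately show ?thesis using assms(3) by (simp add: is_cond_exp_def)
qed

lemma is_cond_exp_measurable: "is_cond_exp M G X V \<Longrightarrow> V \<in> borel_measurable G"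
  by (simp add: is_cond_exp_def)

lemma is_cond_exp_zero_subalgebra:
  assumes "is_cond_exp M G X (\<lambda>_. 0)" "sets H \<subseteq> sets G"
  shows "is_cond_exp M H X (\<lambda>_. 0)"
  using assms by (auto simp: is_cond_exp_def)

context prob_space
begin

lemma is_cond_exp_real_cond_exp:
  assumes G: "subalgebra M G" and f: "integrable M f"
  shows "is_cond_exp M G f (real_cond_exp M G f)"
proof -
  interpret sigma_finite_subalgebra M G by (rule subalgebra_sigma_finite[OF G])
  show ?thesis
    using f real_cond_exp_int(1)[OF f] real_cond_exp_intA[OF f] by (auto simp: is_cond_exp_def)
qed

lemma is_cond_exp_simple_cond_exp:
  fixes Z :: "'a \<Rightarrow> 'b::{banach, second_countable_topology}"
  assumes G: "subalgebra M G" and Z: "simple_function M Z"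
  shows "is_cond_exp M G Z (simple_cond_exp M G Z)"
proof -
  define E where "E y = Z -` {y} \<inter> space M" for y
  have E: "E y \<in> sets M" for y using Z unfolding E_def by (rule simple_functionD)
  have "is_cond_exp M G (\<lambda>x. \<Sum>y\<in>Z ` space M. indicator (E y) x *\<^sub>R y)
      (\<lambda>x. \<Sum>y\<in>Z ` space M. real_cond_exp M G (indicator (E y)) x *\<^sub>R y)"
  proof (intro is_cond_exp_sum[OF G])
    fix y
    have "integrable M (indicator (E y) :: 'a \<Rightarrow> real)"
      using E by (rule integrable_real_indicator) (simp add: emeasure_eq_measure)
    from is_cond_exp_linear[OF bounded_linear_scaleR_left G is_cond_exp_real_cond_exp[OF G this], of y]
    show "is_cond_exp M G (\<lambda>x. indicator (E y) x *\<^sub>R y) (\<lambda>x. real_cond_exp M G (indicator (E y)) x *\<^sub>R y)" .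
  qed
  then have "is_cond_exp M G Z (\<lambda>x. \<Sum>y\<in>Z ` space M. real_cond_exp M G (indicator (E y)) x *\<^sub>R y)"
    by (rule is_cond_exp_cong[OF G, rotated]) (rule simple_function_sum_fibres[OF Z, symmetric, folded E_def])
  then show ?thesis by (simp add: simple_cond_exp_def[abs_def] E_def)
qed

text \<open>Each conditional expectation is a contraction, so the sum has \<open>L\<^sup>q\<close>
  norm at most the number of terms times that of \<open>Z\<close>; the slightly larger power
  \<open>q + 1\<close> comes from bounding the power of a sum term by term.\<close>

lemma signed_cond_exp_sum_contraction:
  fixes V :: "'i \<Rightarrow> 'a \<Rightarrow> 'b::{banach, second_countable_topology}"
  assumes T: "finite T" and G: "\<And>k. k \<in> T \<Longrightarrow> subalgebra M (G k)"
    and ce: "\<And>k. k \<in> T \<Longrightarrow> is_cond_exp M (G k) Z (V k)"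
    and e: "\<And>k. k \<in> T \<Longrightarrow> \<bar>\<epsilon> k\<bar> = 1"
    and q: "1 \<le> q" and Zq: "integrable M (\<lambda>x. norm (Z x) powr q)"
  shows "integrable M (\<lambda>x. norm (\<Sum>k\<in>T. \<epsilon> k *\<^sub>R V k x) powr q)"
    and "(\<integral>x. norm (\<Sum>k\<in>T. \<epsilon> k *\<^sub>R V k x) powr q \<partial>M)
      \<le> real (card T) powr (q + 1) * (\<integral>x. norm (Z x) powr q \<partial>M)"
proof -
  have Vm: "V k \<in> borel_measurable M" if "k \<in> T" for k
    using ce[OF that] by (auto simp: is_cond_exp_def)
  have Vq: "integrable M (\<lambda>x. norm (V k x) powr q)" if "k \<in> T" for k
    by (rule is_cond_exp_powr_contraction(1)[OF equivalent_norm_norm G[OF that] ce[OF that] q Zq])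
  have le: "norm (\<Sum>k\<in>T. \<epsilon> k *\<^sub>R V k x) powr q \<le> real (card T) powr q * (\<Sum>k\<in>T. norm (V k x) powr q)" for x
  proof -
    have "norm (\<Sum>k\<in>T. \<epsilon> k *\<^sub>R V k x) \<le> (\<Sum>k\<in>T. norm (V k x))"
      by (rule sum_norm_le) (simp add: e)
    then have "norm (\<Sum>k\<in>T. \<epsilon> k *\<^sub>R V k x) powr q \<le> (\<Sum>k\<in>T. norm (V k x)) powr q"
      using q by (intro powr_mono2) auto
    also have "\<dots> \<le> real (card T) powr q * (\<Sum>k\<in>T. norm (V k x) powr q)"
      using q by (intro powr_sum_le T) auto
    finally show ?thesis .
  qed
  have int: "integrable M (\<lambda>x. real (card T) powr q * (\<Sum>k\<in>T. norm (V k x) powr q))"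
    using Vq by auto
  have [measurable]: "(\<lambda>x. \<Sum>k\<in>T. \<epsilon> k *\<^sub>R V k x) \<in> borel_measurable M"
    using Vm by (intro borel_measurable_sum borel_measurable_scaleR) auto
  have meas: "(\<lambda>x. norm (\<Sum>k\<in>T. \<epsilon> k *\<^sub>R V k x) powr q) \<in> borel_measurable M"
    by measurable
  show i: "integrable M (\<lambda>x. norm (\<Sum>k\<in>T. \<epsilon> k *\<^sub>R V k x) powr q)"
    using le by (intro Bochner_Integration.integrable_bound[OF int meas] AE_I2) (simp add: sum_nonneg)
  have "(\<integral>x. norm (\<Sum>k\<in>T. \<epsilon> k *\<^sub>R V k x) powr q \<partial>M)
      \<le> (\<integral>x. real (card T) powr q * (\<Sum>k\<in>T. norm (V k x) powr q) \<partial>M)"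
    by (intro integral_mono[OF i int] le)
  also have "\<dots> = real (card T) powr q * (\<Sum>k\<in>T. \<integral>x. norm (V k x) powr q \<partial>M)"
    using Vq by (simp add: Bochner_Integration.integral_sum)
  also have "\<dots> \<le> real (card T) powr q * (\<Sum>k\<in>T. \<integral>x. norm (Z x) powr q \<partial>M)"
    using is_cond_exp_powr_contraction(2)[OF equivalent_norm_norm G ce q Zq]
    by (intro mult_left_mono sum_mono) auto
  also have "\<dots> = real (card T) powr (q + 1) * (\<integral>x. norm (Z x) powr q \<partial>M)"
    by (cases "T = {}") (simp_all add: powr_add)
  finally show "(\<integral>x. norm (\<Sum>k\<in>T. \<epsilon> k *\<^sub>R V k x) powr q \<partial>M)
      \<le> real (card T) powr (q + 1) * (\<integral>x. norm (Z x) powr q \<partial>M)" .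
qed

end

locale commuting_filtration = prob_space M for M :: "'a measure" +
  fixes F :: "int ^ 'd \<Rightarrow> 'a measure"
  assumes commuting: "completely_commuting_filtration M F"
begin

lemma F_subalgebra: "subalgebra M (F i)"
  using commuting by (simp add: completely_commuting_filtration_def)

lemma F_mono: "i \<le> j \<Longrightarrow> sets (F i) \<subseteq> sets (F j)"
  using commuting by (simp add: completely_commuting_filtration_def)

lemma F_measurable_mono: "i \<le> j \<Longrightarrow> f \<in> borel_measurable (F i) \<Longrightarrow> f \<in> borel_measurable (F j)"
  using F_mono[of i j] F_subalgebra[of i] F_subalgebra[of j]
  by (intro measurable_from_subalg[of "F j" "F i"]) (auto simp: subalgebra_def)

lemma is_cond_exp_simple_cond_exp_commute:
  fixes Z :: "'a \<Rightarrow> 'b::{banach, second_countable_topology}"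
  assumes Z: "simple_function M Z"
  shows "is_cond_exp M (F j) (simple_cond_exp M (F i) Z)
    (simple_cond_exp M (F (\<chi> l. min (i $ l) (j $ l))) Z)"
proof -
  define k where "k = (\<chi> l. min (i $ l) (j $ l))"
  have kj: "k \<le> j" by (simp add: k_def less_eq_vec_def)
  have real: "is_cond_exp M (F j) (real_cond_exp M (F i) U) (real_cond_exp M (F k) U)"
    if U: "integrable M U" for U
  proof -
    define W where "W = real_cond_exp M (F i) U"
    have W: "integrable M W"
      using is_cond_exp_real_cond_exp[OF F_subalgebra U] by (simp add: W_def is_cond_exp_def)
    have ceW: "is_cond_exp M (F j) W (real_cond_exp M (F j) W)"
      by (rule is_cond_exp_real_cond_exp[OF F_subalgebra W])
    have ceU: "is_cond_exp M (F k) U (real_cond_exp M (F k) U)"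
      by (rule is_cond_exp_real_cond_exp[OF F_subalgebra U])
    have ae: "AE x in M. real_cond_exp M (F j) W x = real_cond_exp M (F k) U x"
      using commuting U unfolding completely_commuting_filtration_def W_def k_def by blast
    have "(LINT x:B|M. real_cond_exp M (F j) W x) = (LINT x:B|M. real_cond_exp M (F k) U x)"
      if "B \<in> sets (F j)" for B
    proof -
      have [measurable]: "B \<in> sets M" using that F_subalgebra[of j] by (auto simp: subalgebra_def)
      show ?thesis
        unfolding set_lebesgue_integral_def
        using ae ceW ceU by (intro integral_cong_AE) (auto simp: is_cond_exp_def)
    qed
    moreover have "real_cond_exp M (F k) U \<in> borel_measurable (F j)"
      by (rule F_measurable_mono[OF kj is_cond_exp_measurable[OF ceU]])
    ultimately show ?thesis
      using ceW ceU W unfolding W_def by (auto simp: is_cond_exp_def)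
  qed
  show ?thesis
    unfolding simple_cond_exp_def[abs_def] k_def[symmetric]
  proof (intro is_cond_exp_sum[OF F_subalgebra])
    fix y
    have "Z -` {y} \<inter> space M \<in> sets M" using Z by (rule simple_functionD)
    then have "integrable M (indicator (Z -` {y} \<inter> space M) :: 'a \<Rightarrow> real)"
      by (rule integrable_real_indicator) (simp add: emeasure_eq_measure)
    from is_cond_exp_linear[OF bounded_linear_scaleR_left F_subalgebra real[OF this], of y]
    show "is_cond_exp M (F j)
      (\<lambda>x. real_cond_exp M (F i) (indicator (Z -` {y} \<inter> space M)) x *\<^sub>R y)
      (\<lambda>x. real_cond_exp M (F k) (indicator (Z -` {y} \<inter> space M)) x *\<^sub>R y)" .
  qed
qed

lemma orth_projection_measurable:
  fixes Z :: "'a \<Rightarrow> 'b::{banach, second_countable_topology}"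
  assumes Z: "simple_function M Z"
  shows "orth_projection M F i Z \<in> borel_measurable (F i)"
proof -
  have "simple_cond_exp M (F (lower S i)) Z \<in> borel_measurable (F i)" for S
    by (rule F_measurable_mono[OF lower_le is_cond_exp_measurable[OF
          is_cond_exp_simple_cond_exp[OF F_subalgebra Z]]])
  then show ?thesis unfolding orth_projection_def[abs_def] by measurable
qed

text \<open>Let \<open>l\<close> be a coordinate with \<open>j $ l < i $ l\<close>. Conditioning
  on \<open>F j\<close> replaces the index \<open>lower S i\<close> by its minimum with
  \<open>j\<close>, which does not see whether \<open>l\<close> belongs to \<open>S\<close>, so
  the terms for \<open>S\<close> and \<open>insert l S\<close> cancel.\<close>

lemma orth_projection_orth:
  fixes Z :: "'a \<Rightarrow> 'b::{banach, second_countable_topology}"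
  assumes Z: "simple_function M Z" and ij: "\<not> i \<le> j"
  shows "is_cond_exp M (F j) (orth_projection M F i Z) (\<lambda>_. 0)"
proof -
  obtain l where l: "j $ l < i $ l" using ij by (auto simp: less_eq_vec_def not_le)
  define k where "k S = (\<chi> m. min (lower S i $ m) (j $ m))" for S
  have "k (insert l S) = k S" if "l \<notin> S" for S
    using l that by (auto simp: k_def lower_def vec_eq_iff)
  then have "(\<Sum>S\<in>UNIV. (- 1) ^ card S *\<^sub>R simple_cond_exp M (F (k S)) Z x) = 0" for x
    by (intro sum_subsets_cancel[of l]) simp
  moreover have "is_cond_exp M (F j) (orth_projection M F i Z)
      (\<lambda>x. \<Sum>S\<in>UNIV. (- 1) ^ card S *\<^sub>R simple_cond_exp M (F (k S)) Z x)"
    unfolding orth_projection_def[abs_def]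
  proof (intro is_cond_exp_sum[OF F_subalgebra])
    fix S :: "'d set"
    from is_cond_exp_linear[OF bounded_linear_scaleR_right F_subalgebra
        is_cond_exp_simple_cond_exp_commute[OF Z, of j "lower S i"], of "(- 1) ^ card S"]
    show "is_cond_exp M (F j) (\<lambda>x. (- 1) ^ card S *\<^sub>R simple_cond_exp M (F (lower S i)) Z x)
      (\<lambda>x. (- 1) ^ card S *\<^sub>R simple_cond_exp M (F (k S)) Z x)"
      by (simp add: k_def)
  qed
  ultimately show ?thesis by simp
qed

lemma orth_projection_contraction:
  fixes Z :: "'a \<Rightarrow> 'b::{banach, second_countable_topology}"
  assumes Z: "simple_function M Z" and q: "1 \<le> q"
  shows "integrable M (\<lambda>x. norm (orth_projection M F i Z x) powr q)"
    and "(\<integral>x. norm (orth_projection M F i Z x) powr q \<partial>M)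
      \<le> (2 ^ CARD('d)) powr (q + 1) * (\<integral>x. norm (Z x) powr q \<partial>M)"
proof -
  have "simple_function M (\<lambda>x. norm (Z x) powr q)"
    using Z by (rule simple_function_compose1)
  then have Zq: "integrable M (\<lambda>x. norm (Z x) powr q)" by (rule simple_function_integrable)
  note ce = is_cond_exp_simple_cond_exp[OF F_subalgebra Z]
  show "integrable M (\<lambda>x. norm (orth_projection M F i Z x) powr q)"
    unfolding orth_projection_def
    by (rule signed_cond_exp_sum_contraction(1)[OF _ F_subalgebra ce _ q Zq]) (auto simp: power_abs)
  show "(\<integral>x. norm (orth_projection M F i Z x) powr q \<partial>M)
      \<le> (2 ^ CARD('d)) powr (q + 1) * (\<integral>x. norm (Z x) powr q \<partial>M)"
    unfolding orth_projection_def card_sets[symmetric]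
    by (rule signed_cond_exp_sum_contraction(2)[OF _ F_subalgebra ce _ q Zq]) (auto simp: power_abs)
qed

end

locale orthomartingale = commuting_filtration M F
  for M :: "'a measure" and F :: "int ^ 'd \<Rightarrow> 'a measure" +
  fixes X :: "int ^ 'd \<Rightarrow> 'a \<Rightarrow> 'b::{banach, second_countable_topology}"
  assumes X_adapted: "\<And>i. X i \<in> borel_measurable (F i)"
    and X_diff: "\<And>i l. is_cond_exp M (F (i - axis l 1)) (X i) (\<lambda>_. 0)"
begin

lemma X_integrable: "integrable M (X i)"
  using X_diff by (simp add: is_cond_exp_def)

lemma X_measurable [measurable]: "X i \<in> borel_measurable M"
  using X_integrable by auto

text \<open>The conditional expectation of \<open>X i\<close> given \<open>F (lower S i)\<close>
  is \<open>X i\<close> for empty \<open>S\<close> and zero otherwise. Hence \<open>X i\<close> is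
  its own projection, and the left-hand side is the projection of \<open>X i - Z\<close>, although
  \<open>X i\<close> need not have finitely many values.\<close>

lemma diff_orth_projection_contraction:
  assumes Z: "simple_function M Z" and q: "1 \<le> q"
    and Zq: "integrable M (\<lambda>x. norm (X i x - Z x) powr q)"
  shows "integrable M (\<lambda>x. norm (X i x - orth_projection M F i Z x) powr q)"
    and "(\<integral>x. norm (X i x - orth_projection M F i Z x) powr q \<partial>M)
      \<le> (2 ^ CARD('d)) powr (q + 1) * (\<integral>x. norm (X i x - Z x) powr q \<partial>M)"
proof -
  \<comment> \<open>\<open>V S\<close> is the conditional expectation of \<open>X i - Z\<close>
    given \<open>F (lower S i)\<close>.\<close>
  define V where "V S x = (if S = {} then X i x else 0) - simple_cond_exp M (F (lower S i)) Z x" for S x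
  have ce: "is_cond_exp M (F (lower S i)) (\<lambda>x. X i x - Z x) (V S)" for S
  proof -
    have X: "is_cond_exp M (F (lower S i)) (X i) (\<lambda>x. if S = {} then X i x else 0)"
    proof (cases "S = {}")
      case True
      then show ?thesis by (simp add: lower_empty is_cond_exp_self[OF X_integrable X_adapted])
    next
      case False
      then obtain l where l: "l \<in> S" by blast
      show ?thesis
        using False is_cond_exp_zero_subalgebra[OF X_diff F_mono[OF lower_le_axis[OF l]]] by simp
    qed
    have "is_cond_exp M (F (lower S i)) (\<lambda>x. X i x + - Z x)
        (\<lambda>x. (if S = {} then X i x else 0) + - simple_cond_exp M (F (lower S i)) Z x)"
      by (intro is_cond_exp_add[OF F_subalgebra] X
          is_cond_exp_linear[OF bounded_linear_minus[OF bounded_linear_ident] F_subalgebra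
            is_cond_exp_simple_cond_exp[OF F_subalgebra Z]])
    then show ?thesis by (simp add: V_def[abs_def])
  qed
  have eq: "(\<Sum>S\<in>UNIV. (- 1) ^ card S *\<^sub>R V S x) = X i x - orth_projection M F i Z x" for x
  proof -
    have "(\<Sum>S\<in>UNIV. (- 1) ^ card S *\<^sub>R V S x)
        = (\<Sum>S\<in>(UNIV :: 'd set set). if S = {} then X i x else 0) - orth_projection M F i Z x"
      unfolding V_def orth_projection_def sum_subtractf[symmetric]
      by (intro sum.cong) (auto simp: scaleR_diff_right)
    then show ?thesis by simp
  qed
  show "integrable M (\<lambda>x. norm (X i x - orth_projection M F i Z x) powr q)"
    unfolding eq[symmetric]
    by (rule signed_cond_exp_sum_contraction(1)[OF _ F_subalgebra ce _ q Zq]) (auto simp: power_abs)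
  show "(\<integral>x. norm (X i x - orth_projection M F i Z x) powr q \<partial>M)
      \<le> (2 ^ CARD('d)) powr (q + 1) * (\<integral>x. norm (X i x - Z x) powr q \<partial>M)"
    unfolding eq[symmetric] card_sets[symmetric]
    by (rule signed_cond_exp_sum_contraction(2)[OF _ F_subalgebra ce _ q Zq]) (auto simp: power_abs)
qed

text \<open>The filtration commutes only on real-valued functions. The property holds for the
  projections of simple approximations of \<open>X i\<close>, which converge to \<open>X i\<close>
  in \<open>L\<^sup>1\<close>.\<close>

lemma X_orth:
  assumes ij: "\<not> i \<le> j"
  shows "is_cond_exp M (F j) (X i) (\<lambda>_. 0)"
proof -
  have "(LINT x:B|M. X i x) = 0" if B: "B \<in> sets (F j)" for B
  proof -
    have BM: "B \<in> sets M" using B F_subalgebra[of j] by (auto simp: subalgebra_def)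
    obtain g where g: "\<And>m. simple_function M (g m)" "\<And>x. x \<in> space M \<Longrightarrow> (\<lambda>m. g m x) \<longlonglongrightarrow> X i x"
      "\<And>m x. x \<in> space M \<Longrightarrow> dist (g m x) 0 \<le> 2 * dist (X i x) 0"
      using borel_measurable_implies_sequence_metric[OF X_measurable[of i], of 0] by metis
    have gm[measurable]: "g m \<in> borel_measurable M" for m using g(1) by (rule borel_measurable_simple_function)
    define c where "c = (2 ^ CARD('d) :: real) powr (1 + 1)"
    have le: "norm (LINT x:B|M. X i x) \<le> c * (\<integral>x. norm (X i x - g m x) \<partial>M)" for m
    proof -
      define Y where "Y = orth_projection M F i (g m)"
      have ceY: "is_cond_exp M (F j) Y (\<lambda>_. 0)"
        unfolding Y_def by (rule orth_projection_orth[OF g(1) ij])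
      then have Y: "integrable M Y" "(LINT x:B|M. Y x) = 0" using B by (auto simp: is_cond_exp_def)
      have Zi: "integrable M (\<lambda>x. norm (X i x - g m x) powr 1)"
        using X_integrable[of i] simple_function_integrable[OF g(1)[of m]] by simp
      have "(LINT x:B|M. X i x) = (LINT x:B|M. X i x - Y x)"
        using Y X_integrable BM by (subst set_integral_diff) (auto simp: set_integrable_def intro!: integrable_mult_indicator)
      also have "norm \<dots> \<le> (\<integral>x. norm (indicator B x *\<^sub>R (X i x - Y x)) \<partial>M)"
        unfolding set_lebesgue_integral_def by (rule integral_norm_bound)
      also have "\<dots> \<le> (\<integral>x. norm (X i x - Y x) \<partial>M)"
        using Y X_integrable[of i] BM
        by (intro integral_mono integrable_norm integrable_mult_indicator) (auto simp: indicator_def)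
      also have "\<dots> \<le> c * (\<integral>x. norm (X i x - g m x) \<partial>M)"
        using diff_orth_projection_contraction(2)[OF g(1) _ Zi] by (simp add: Y_def c_def)
      finally show ?thesis .
    qed
    have "(\<lambda>m. \<integral>x. norm (X i x - g m x) \<partial>M) \<longlonglongrightarrow> (\<integral>x. 0 \<partial>M)"
    proof (rule integral_dominated_convergence[where w = "\<lambda>x. 3 * norm (X i x)"])
      show "integrable M (\<lambda>x. 3 * norm (X i x))" using X_integrable[of i] by auto
      show "AE x in M. (\<lambda>m. norm (X i x - g m x)) \<longlonglongrightarrow> 0"
      proof (rule AE_I2)
        fix x assume "x \<in> space M"
        from tendsto_diff[OF tendsto_const[of "X i x"] g(2)[OF this]]
        show "(\<lambda>m. norm (X i x - g m x)) \<longlonglongrightarrow> 0" by (auto intro: tendsto_norm_zero)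
      qed
      show "AE x in M. norm (norm (X i x - g m x)) \<le> 3 * norm (X i x)" for m
      proof (rule AE_I2)
        fix x assume "x \<in> space M"
        then show "norm (norm (X i x - g m x)) \<le> 3 * norm (X i x)"
          using g(3)[of x m] norm_triangle_ineq4[of "X i x" "g m x"] by simp
      qed
    qed auto
    then have "(\<lambda>m. c * (\<integral>x. norm (X i x - g m x) \<partial>M)) \<longlonglongrightarrow> c * 0"
      by (intro tendsto_mult tendsto_const) simp
    then have "norm (LINT x:B|M. X i x) \<le> c * 0"
      by (rule LIMSEQ_le_const) (use le in auto)
    then show ?thesis by simp
  qed
  then show ?thesis using X_integrable by (simp add: is_cond_exp_def)
qed

lemma X_orth_differences: "orth_differences M F X"
  using X_adapted X_orth by (simp add: orth_differences_def)

end

section \<open>Moments and tails of weighted sums\<close>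

lemma smooth_two_point_renorming_ex:
  assumes "r_smooth TYPE('b::real_normed_vector) r" "r \<le> 2" "1 < p" "p < r" "p \<le> q"
  shows "\<exists>(N :: 'b \<Rightarrow> real) K. equivalent_norm N \<and> 1 \<le> K \<and> smooth_two_point N p q K"
proof -
  obtain N :: "'b \<Rightarrow> real" and K0 where N: "equivalent_norm N"
    and sm: "\<forall>t>0. \<forall>x y. N x = 1 \<and> N y = 1 \<longrightarrow> (N (x + t *\<^sub>R y) + N (x - t *\<^sub>R y) - 2) / t powr r \<le> K0"
    using assms(1) unfolding r_smooth_def by blast
  obtain K where K: "0 \<le> K" "smooth_two_point N p q K"
    using smooth_two_point_ex[OF N sm assms(2-5)] by blast
  have "smooth_two_point N p q (max 1 K)"
    unfolding smooth_two_point_def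
  proof (intro allI)
    fix x y :: 'b
    have "N (x + y) powr q + N (x - y) powr q \<le> 2 * (N x powr p + K * N y powr p) powr (q / p)"
      using K(2) by (simp add: smooth_two_point_def)
    also have "\<dots> \<le> 2 * (N x powr p + max 1 K * N y powr p) powr (q / p)"
      using K(1) assms(3,5) by (intro mult_left_mono powr_mono2 add_left_mono mult_right_mono) auto
    finally show "N (x + y) powr q + N (x - y) powr q
      \<le> 2 * (N x powr p + max 1 K * N y powr p) powr (q / p)" .
  qed
  then show ?thesis using N by (intro exI[of _ N] exI[of _ "max 1 K"]) auto
qed

lemma orth_differences_blinfun:
  fixes a :: "int ^ 'd \<Rightarrow> ('b::{banach, second_countable_topology} \<Rightarrow>\<^sub>L 'b)"
  assumes F: "\<And>i. subalgebra M (F i)" and Y: "orth_differences M F Y"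
  shows "orth_differences M F (\<lambda>i x. blinfun_apply (a i) (Y i x))"
  unfolding orth_differences_def
proof (intro conjI allI impI)
  fix i j :: "int ^ 'd"
  have "blinfun_apply (a i) \<in> borel_measurable borel"
    by (intro borel_measurable_continuous_onI linear_continuous_on blinfun.bounded_linear_right)
  then show "(\<lambda>x. blinfun_apply (a i) (Y i x)) \<in> borel_measurable (F i)"
    using Y measurable_compose unfolding orth_differences_def by blast
  assume "\<not> i \<le> j"
  then have "is_cond_exp M (F j) (Y i) (\<lambda>_. 0)" using Y by (simp add: orth_differences_def)
  from is_cond_exp_linear[OF blinfun.bounded_linear_right F this, of "a i"]
  show "is_cond_exp M (F j) (\<lambda>x. blinfun_apply (a i) (Y i x)) (\<lambda>_. 0)" by (simp add: blinfun.zero_right)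
qed

lemma orth_differences_diff:
  assumes F: "\<And>i. subalgebra M (F i)" and X: "orth_differences M F X" and Y: "orth_differences M F Y"
  shows "orth_differences M F (\<lambda>i x. X i x - Y i x)"
  unfolding orth_differences_def
proof (intro conjI allI impI)
  fix i j
  show "(\<lambda>x. X i x - Y i x) \<in> borel_measurable (F i)"
    using X Y by (auto simp: orth_differences_def intro!: borel_measurable_diff)
  assume "\<not> i \<le> j"
  then have Xi: "is_cond_exp M (F j) (X i) (\<lambda>_. 0)" and Yi: "is_cond_exp M (F j) (Y i) (\<lambda>_. 0)"
    using X Y by (auto simp: orth_differences_def)
  from is_cond_exp_add[OF F Xi is_cond_exp_linear[OF bounded_linear_minus[OF bounded_linear_ident] F Yi]]
  show "is_cond_exp M (F j) (\<lambda>x. X i x - Y i x) (\<lambda>_. 0)" by simp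
qed

context prob_space
begin

lemma prob_norm_gt_le:
  fixes f :: "'a \<Rightarrow> 'b::{banach, second_countable_topology}"
  assumes f[measurable]: "f \<in> borel_measurable M" and fq: "integrable M (\<lambda>x. norm (f x) powr q)"
    and c: "0 < c" and q: "0 < q"
  shows "prob {x \<in> space M. norm (f x) > c} \<le> (\<integral>x. norm (f x) powr q \<partial>M) / c powr q"
proof -
  have "prob {x \<in> space M. norm (f x) > c} \<le> prob {x \<in> space M. norm (f x) powr q \<ge> c powr q}"
    using c q by (intro finite_measure_mono) (auto intro!: powr_mono2)
  also have "\<dots> \<le> (\<integral>x. norm (f x) powr q \<partial>M) / c powr q"
    using c by (intro integral_Markov_inequality_measure[OF fq]) auto
  finally show ?thesis .
qed

lemma powr_integrable_smaller_exponent: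
  fixes f :: "'a \<Rightarrow> 'b::{banach, second_countable_topology}"
  assumes [measurable]: "f \<in> borel_measurable M" and fs: "integrable M (\<lambda>x. norm (f x) powr s)"
    and p: "0 \<le> p" "p \<le> s"
  shows "integrable M (\<lambda>x. norm (f x) powr p)"
proof (rule Bochner_Integration.integrable_bound)
  show "integrable M (\<lambda>x. 1 + norm (f x) powr s)" using fs by auto
  have "norm (f x) powr p \<le> 1 + norm (f x) powr s" for x
  proof (cases "norm (f x) \<le> 1")
    case True
    then have "norm (f x) powr p \<le> 1" using p by (intro powr_le1) auto
    then show ?thesis using powr_ge_zero[of "norm (f x)" s] by linarith
  next
    case False
    then have "norm (f x) powr p \<le> norm (f x) powr s" using p by (intro powr_mono) auto
    then show ?thesis by simp
  qed
  then show "AE x in M. norm (norm (f x) powr p) \<le> norm (1 + norm (f x) powr s)"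
    by (auto simp: abs_of_nonneg)
qed simp

end

context commuting_filtration
begin

text \<open>The constant depends on the space, the exponents and the dimension, but neither on the
  operators nor on the index set; uniformity in \<open>n\<close> comes from here.\<close>

lemma orth_sum_moment_bound:
  assumes "r_smooth TYPE('b::{banach, second_countable_topology}) r" "r \<le> 2" "1 < p" "p < r" "p \<le> q"
  obtains C where "0 \<le> C"
    "\<And>(a :: int ^ 'd \<Rightarrow> ('b \<Rightarrow>\<^sub>L 'b)) Y J m. orth_differences M F Y \<Longrightarrow>
       (\<And>i. integrable M (\<lambda>x. norm (Y i x) powr q)) \<Longrightarrow>
       (\<And>i. (\<integral>x. norm (Y i x) powr q \<partial>M) \<le> m) \<Longrightarrow> finite J \<Longrightarrow>
       integrable M (\<lambda>x. norm (\<Sum>i\<in>J. blinfun_apply (a i) (Y i x)) powr q) \<and>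
       (\<integral>x. norm (\<Sum>i\<in>J. blinfun_apply (a i) (Y i x)) powr q \<partial>M) \<le> C * (\<Sum>i\<in>J. norm (a i) powr p) powr (q / p) * m"
proof -
  obtain N :: "'b \<Rightarrow> real" and K where N: "equivalent_norm N" and K: "1 \<le> K" and tp: "smooth_two_point N p q K"
    using smooth_two_point_renorming_ex[OF assms] by blast
  obtain c where c: "c \<ge> 1" "\<And>x. N x \<le> c * norm x" "\<And>x. norm x \<le> c * N x"
    using equivalent_norm_bounds[OF N] by metis
  note equivalent_norm_measurable[OF N, measurable]
  note Nn = equivalent_normD[OF N]
  have p: "1 \<le> p" "0 < p" and q: "1 \<le> q" "0 < q" using assms by auto
  define K' where "K' = (2 * K) ^ CARD('d) * c powr p"
  have K': "0 \<le> K'" using K by (simp add: K'_def)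
  show thesis
  proof (rule that[of "c powr q * K' powr (q / p)"])
    fix a :: "int ^ 'd \<Rightarrow> ('b \<Rightarrow>\<^sub>L 'b)" and Y :: "int ^ 'd \<Rightarrow> 'a \<Rightarrow> 'b" and J :: "(int ^ 'd) set" and m :: real
    assume Y: "orth_differences M F Y" and Yq: "\<And>i. integrable M (\<lambda>x. norm (Y i x) powr q)"
      and Ym: "\<And>i. (\<integral>x. norm (Y i x) powr q \<partial>M) \<le> m" and J: "finite J"
    have m0: "0 \<le> m" using Ym[of undefined] by (rule order_trans[rotated]) simp
    define W where "W i x = blinfun_apply (a i) (Y i x)" for i x
    have W: "orth_differences M F W"
      unfolding W_def by (rule orth_differences_blinfun[OF F_subalgebra Y])
    have "Y i \<in> borel_measurable (F i)" "W i \<in> borel_measurable (F i)" for i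
      using W Y by (auto simp: orth_differences_def)
    then have [measurable]: "Y i \<in> borel_measurable M" "W i \<in> borel_measurable M" for i
      using measurable_from_subalg[OF F_subalgebra] by blast+
    have NW: "N (W i x) powr q \<le> (c * norm (a i)) powr q * norm (Y i x) powr q" for i x
    proof -
      have "N (W i x) \<le> c * norm (W i x)" by (rule c)
      also have "\<dots> \<le> c * (norm (a i) * norm (Y i x))"
        unfolding W_def using c by (intro mult_left_mono norm_blinfun) auto
      finally have "N (W i x) powr q \<le> (c * norm (a i) * norm (Y i x)) powr q"
        using q Nn by (intro powr_mono2) (auto simp: mult.assoc)
      then show ?thesis using c by (simp add: powr_mult)
    qed
    have Wint: "integrable M (\<lambda>x. (c * norm (a i)) powr q * norm (Y i x) powr q)" for i
      using Yq by auto
    have NWq: "integrable M (\<lambda>x. N (W i x) powr q)" for i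
      using NW by (intro Bochner_Integration.integrable_bound[OF Wint[of i]]) auto
    have Lq: "Lq_norm M N q (W i) powr p \<le> c powr p * norm (a i) powr p * m powr (p / q)" for i
    proof -
      have "(\<integral>x. N (W i x) powr q \<partial>M) \<le> (c * norm (a i)) powr q * (\<integral>x. norm (Y i x) powr q \<partial>M)"
        using integral_mono[OF NWq Wint NW] by simp
      also have "\<dots> \<le> (c * norm (a i)) powr q * m" using Ym by (intro mult_left_mono) auto
      finally have "(\<integral>x. N (W i x) powr q \<partial>M) powr (p / q) \<le> ((c * norm (a i)) powr q * m) powr (p / q)"
        using p q by (intro powr_mono2) auto
      also have "\<dots> = c powr p * norm (a i) powr p * m powr (p / q)"
        using c q m0 by (simp add: powr_mult powr_powr)
      finally show ?thesis by (simp add: Lq_norm_def powr_powr)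
    qed
    define \<Sigma> where "\<Sigma> = (\<Sum>i\<in>J. norm (a i) powr p)"
    have \<Sigma>: "0 \<le> \<Sigma>" by (simp add: \<Sigma>_def sum_nonneg)
    have "Lq_norm M N q (\<lambda>x. \<Sum>i\<in>J. W i x) powr p \<le> (2 * K) ^ CARD('d) * (\<Sum>i\<in>J. Lq_norm M N q (W i) powr p)"
      by (rule Lq_norm_orth_sum[OF N tp K p(1) assms(5) F_subalgebra F_mono W NWq J])
    also have "\<dots> \<le> (2 * K) ^ CARD('d) * (\<Sum>i\<in>J. c powr p * norm (a i) powr p * m powr (p / q))"
      using K Lq by (intro mult_left_mono sum_mono) auto
    also have "\<dots> = K' * \<Sigma> * m powr (p / q)"
      by (simp add: K'_def \<Sigma>_def sum_distrib_left sum_distrib_right mult_ac)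
    finally have Lp: "(\<integral>x. N (\<Sum>i\<in>J. W i x) powr q \<partial>M) powr (p / q) \<le> K' * \<Sigma> * m powr (p / q)"
      by (simp add: Lq_norm_def powr_powr)
    have "(\<integral>x. N (\<Sum>i\<in>J. W i x) powr q \<partial>M)
        = ((\<integral>x. N (\<Sum>i\<in>J. W i x) powr q \<partial>M) powr (p / q)) powr (q / p)"
      using p q by (simp add: powr_powr)
    also have "\<dots> \<le> (K' * \<Sigma> * m powr (p / q)) powr (q / p)"
      using p q by (intro powr_mono2 Lp) auto
    also have "\<dots> = K' powr (q / p) * \<Sigma> powr (q / p) * m"
      using p q K' \<Sigma> m0 by (simp add: powr_mult powr_powr)
    finally have bound: "(\<integral>x. N (\<Sum>i\<in>J. W i x) powr q \<partial>M) \<le> K' powr (q / p) * \<Sigma> powr (q / p) * m" .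
    have NS: "integrable M (\<lambda>x. c powr q * N (\<Sum>i\<in>J. W i x) powr q)"
      using NWq by (intro integrable_mult_right powr_integrable_sum[OF N q(1)]) auto
    have le: "norm (\<Sum>i\<in>J. W i x) powr q \<le> c powr q * N (\<Sum>i\<in>J. W i x) powr q" for x
    proof -
      have "norm (\<Sum>i\<in>J. W i x) powr q \<le> (c * N (\<Sum>i\<in>J. W i x)) powr q"
        using q c by (intro powr_mono2) auto
      then show ?thesis using c Nn by (simp add: powr_mult)
    qed
    have int: "integrable M (\<lambda>x. norm (\<Sum>i\<in>J. W i x) powr q)"
      using le by (intro Bochner_Integration.integrable_bound[OF NS]) auto
    have "(\<integral>x. norm (\<Sum>i\<in>J. W i x) powr q \<partial>M) \<le> c powr q * (\<integral>x. N (\<Sum>i\<in>J. W i x) powr q \<partial>M)"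
      using integral_mono[OF int NS le] by simp
    also have "\<dots> \<le> c powr q * (K' powr (q / p) * \<Sigma> powr (q / p) * m)"
      using bound by (intro mult_left_mono) auto
    finally show "integrable M (\<lambda>x. norm (\<Sum>i\<in>J. blinfun_apply (a i) (Y i x)) powr q) \<and>
       (\<integral>x. norm (\<Sum>i\<in>J. blinfun_apply (a i) (Y i x)) powr q \<partial>M)
         \<le> c powr q * K' powr (q / p) * (\<Sum>i\<in>J. norm (a i) powr p) powr (q / p) * m"
      using int by (simp add: W_def \<Sigma>_def mult_ac)
  qed simp
qed

lemma orth_projection_orth_differences:
  fixes Z :: "int ^ 'd \<Rightarrow> 'a \<Rightarrow> 'b::{banach, second_countable_topology}"
  assumes "\<And>i. simple_function M (Z i)"
  shows "orth_differences M F (\<lambda>i. orth_projection M F i (Z i))"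
  using orth_projection_measurable[OF assms] orth_projection_orth[OF assms]
  by (simp add: orth_differences_def)

end

locale identically_distributed_orthomartingale = orthomartingale M F X
  for M :: "'a measure" and F :: "int ^ 'd \<Rightarrow> 'a measure"
    and X :: "int ^ 'd \<Rightarrow> 'a \<Rightarrow> 'b::{banach, second_countable_topology}" +
  assumes ident: "identically_distributed M X"
begin

lemma distr_X: "distr M borel (X i) = distr M borel (X 1)"
  using ident unfolding identically_distributed_def by blast

lemma integral_X:
  fixes f :: "'b \<Rightarrow> real"
  assumes "f \<in> borel_measurable borel"
  shows "(\<integral>x. f (X i x) \<partial>M) = (\<integral>x. f (X 1 x) \<partial>M)"
    and "integrable M (\<lambda>x. f (X i x)) \<longleftrightarrow> integrable M (\<lambda>x. f (X 1 x))"
  using integral_distr[OF X_measurable[of i] assms] integral_distr[OF X_measurable[of 1] assms]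
    integrable_distr_eq[OF X_measurable[of i] assms] integrable_distr_eq[OF X_measurable[of 1] assms]
    distr_X[of i] by simp_all

text \<open>Marcinkiewicz splitting at height \<open>R\<close>. The truncation \<open>f\<close> is
  approximated by functions \<open>g n\<close> with finitely many values and \<open>norm (g n x)
  \<le> 2 * norm (f x)\<close>. The projections of \<open>g n (X i)\<close> are controlled in
  \<open>L\<^sup>q\<close> and the remainders in \<open>L\<^sup>p\<close>. The probability does
  not depend on \<open>n\<close>, so the approximation error disappears in the limit.\<close>

lemma weighted_sum_tail_bound:
  assumes r: "r_smooth TYPE('b) r" "r \<le> 2" and p: "1 < p" "p < r" and q: "p \<le> q"
    and Xp: "integrable M (\<lambda>x. norm (X 1 x) powr p)"
  obtains C where "0 \<le> C"
    "\<And>(a :: int ^ 'd \<Rightarrow> ('b \<Rightarrow>\<^sub>L 'b)) J c t R. finite J \<Longrightarrow> 0 < t \<Longrightarrow> 0 < R \<Longrightarrow> 0 \<le> c \<Longrightarrow>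
       (\<Sum>i\<in>J. norm (a i) powr p) \<le> c powr p \<Longrightarrow>
       prob {x \<in> space M. norm (\<Sum>i\<in>J. blinfun_apply (a i) (X i x)) > t} \<le>
         C * ((c / t) powr q * (\<integral>x. norm (X 1 x) powr q * indicator {..R} (norm (X 1 x)) \<partial>M)
            + (c / t) powr p * (\<integral>x. norm (X 1 x) powr p * indicator {R<..} (norm (X 1 x)) \<partial>M))"
proof -
  have p0: "1 \<le> p" "0 < p" and q0: "1 \<le> q" "0 < q" using p q by auto
  obtain Cq where Cq: "0 \<le> Cq"
    "\<And>(a :: int ^ 'd \<Rightarrow> ('b \<Rightarrow>\<^sub>L 'b)) Y J m. orth_differences M F Y \<Longrightarrow>
       (\<And>i. integrable M (\<lambda>x. norm (Y i x) powr q)) \<Longrightarrow>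
       (\<And>i. (\<integral>x. norm (Y i x) powr q \<partial>M) \<le> m) \<Longrightarrow> finite J \<Longrightarrow>
       integrable M (\<lambda>x. norm (\<Sum>i\<in>J. blinfun_apply (a i) (Y i x)) powr q) \<and>
       (\<integral>x. norm (\<Sum>i\<in>J. blinfun_apply (a i) (Y i x)) powr q \<partial>M) \<le> Cq * (\<Sum>i\<in>J. norm (a i) powr p) powr (q / p) * m"
    by (rule orth_sum_moment_bound[OF r p q]) blast
  obtain Cp where Cp: "0 \<le> Cp"
    "\<And>(a :: int ^ 'd \<Rightarrow> ('b \<Rightarrow>\<^sub>L 'b)) Y J m. orth_differences M F Y \<Longrightarrow>
       (\<And>i. integrable M (\<lambda>x. norm (Y i x) powr p)) \<Longrightarrow>
       (\<And>i. (\<integral>x. norm (Y i x) powr p \<partial>M) \<le> m) \<Longrightarrow> finite J \<Longrightarrow>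
       integrable M (\<lambda>x. norm (\<Sum>i\<in>J. blinfun_apply (a i) (Y i x)) powr p) \<and>
       (\<integral>x. norm (\<Sum>i\<in>J. blinfun_apply (a i) (Y i x)) powr p \<partial>M) \<le> Cp * (\<Sum>i\<in>J. norm (a i) powr p) powr (p / p) * m"
    by (rule orth_sum_moment_bound[OF r p order_refl]) blast
  define bq where "bq = (2 ^ CARD('d) :: real) powr (q + 1)"
  define bp where "bp = (2 ^ CARD('d) :: real) powr (p + 1)"
  define C where "C = max (Cq * bq * 2 powr q * 2 powr q) (Cp * bp * 2 powr p)"
  have C0: "0 \<le> C" using Cq(1) by (simp add: C_def bq_def le_max_iff_disj)
  show thesis
  proof (rule that[OF C0])
    fix a :: "int ^ 'd \<Rightarrow> ('b \<Rightarrow>\<^sub>L 'b)" and J :: "(int ^ 'd) set" and c t R :: real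
    assume J: "finite J" and t: "0 < t" and R: "0 < R" and c: "0 \<le> c"
      and ac: "(\<Sum>i\<in>J. norm (a i) powr p) \<le> c powr p"
    define f where "f x = (if norm x \<le> R then x else 0)" for x :: 'b
    have fm[measurable]: "f \<in> borel_measurable borel" unfolding f_def[abs_def] by measurable
    define mq where "mq = (\<integral>x. norm (X 1 x) powr q * indicator {..R} (norm (X 1 x)) \<partial>M)"
    define mp where "mp = (\<integral>x. norm (X 1 x) powr p * indicator {R<..} (norm (X 1 x)) \<partial>M)"
    have space_borel: "x \<in> space borel" for x :: 'b by simp
    obtain g where g: "\<And>n. simple_function borel (g n)" "\<And>x. (\<lambda>n. g n x) \<longlonglongrightarrow> f x"
      "\<And>n x. dist (g n x) 0 \<le> 2 * dist (f x) 0"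
      using borel_measurable_implies_sequence_metric[OF fm, of 0] space_borel by metis
    have gm[measurable]: "g n \<in> borel_measurable borel" for n
      using g(1) by (rule borel_measurable_simple_function)
    have gle: "norm (g n x) \<le> 2 * norm (f x)" for n x using g(3)[of n x] by (simp add: dist_norm)
    define e where "e n = (\<integral>x. norm (X 1 x - g n (X 1 x)) powr p \<partial>M)" for n
    have mq_int: "integrable M (\<lambda>x. norm (X 1 x) powr q * indicator {..R} (norm (X 1 x)))"
      using q0 R by (intro integrable_const_bound[where B = "R powr q"])
        (auto simp: indicator_def intro!: powr_mono2)
    have e_int: "integrable M (\<lambda>x. norm (X 1 x - g n (X 1 x)) powr p)" for n
    proof -
      have "simple_function M (\<lambda>x. g n (X 1 x))"
        using simple_function_comp[OF X_measurable g(1)] by (simp add: comp_def)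
      then have "simple_function M (\<lambda>x. norm (- g n (X 1 x)) powr p)"
        by (rule simple_function_compose1)
      then have "integrable M (\<lambda>x. norm (- g n (X 1 x)) powr p)" by (rule simple_function_integrable)
      from powr_integrable_add[OF equivalent_norm_norm p0(1) _ _ Xp this] show ?thesis by simp
    qed
    have e_lim: "e \<longlonglongrightarrow> mp"
      unfolding e_def[abs_def] mp_def
    proof (rule integral_dominated_convergence[where w = "\<lambda>x. 3 powr p * norm (X 1 x) powr p"])
      show "AE x in M. (\<lambda>n. norm (X 1 x - g n (X 1 x)) powr p) \<longlonglongrightarrow> norm (X 1 x) powr p * indicator {R<..} (norm (X 1 x))"
      proof (rule AE_I2)
        fix x
        have "(\<lambda>n. norm (X 1 x - g n (X 1 x)) powr p) \<longlonglongrightarrow> norm (X 1 x - f (X 1 x)) powr p"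
          using p0 by (intro tendsto_powr2 tendsto_norm tendsto_diff g tendsto_const) auto
        moreover have "norm (X 1 x - f (X 1 x)) powr p = norm (X 1 x) powr p * indicator {R<..} (norm (X 1 x))"
          using p0 by (auto simp: f_def indicator_def)
        ultimately show "(\<lambda>n. norm (X 1 x - g n (X 1 x)) powr p) \<longlonglongrightarrow> norm (X 1 x) powr p * indicator {R<..} (norm (X 1 x))" by simp
      qed
      show "AE x in M. norm (norm (X 1 x - g n (X 1 x)) powr p) \<le> 3 powr p * norm (X 1 x) powr p" for n
      proof (rule AE_I2)
        fix x
        have "norm (f (X 1 x)) \<le> norm (X 1 x)" by (simp add: f_def)
        then have "norm (X 1 x - g n (X 1 x)) \<le> 3 * norm (X 1 x)"
          using norm_triangle_ineq4[of "X 1 x" "g n (X 1 x)"] gle[of n "X 1 x"] by linarith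
        then have "norm (X 1 x - g n (X 1 x)) powr p \<le> (3 * norm (X 1 x)) powr p"
          using p0 by (intro powr_mono2) auto
        then show "norm (norm (X 1 x - g n (X 1 x)) powr p) \<le> 3 powr p * norm (X 1 x) powr p"
          by (simp add: powr_mult)
      qed
    qed (use Xp in auto)
    have key: "prob {x \<in> space M. norm (\<Sum>i\<in>J. blinfun_apply (a i) (X i x)) > t}
        \<le> C * ((c / t) powr q * mq + (c / t) powr p * e n)" for n
    proof -
      have Z: "simple_function M (\<lambda>x. g n (X i x))" for i
        using simple_function_comp[OF X_measurable g(1)] by (simp add: comp_def)
      define Y where "Y i = orth_projection M F i (\<lambda>x. g n (X i x))" for i
      define V where "V i x = X i x - Y i x" for i x
      have Y: "orth_differences M F Y"
        unfolding Y_def[abs_def] by (rule orth_projection_orth_differences[OF Z])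
      have V: "orth_differences M F V"
        unfolding V_def[abs_def] by (rule orth_differences_diff[OF F_subalgebra X_orth_differences Y])
      have "Y i \<in> borel_measurable (F i)" for i using Y by (simp add: orth_differences_def)
      then have [measurable]: "Y i \<in> borel_measurable M" for i
        using measurable_from_subalg[OF F_subalgebra] by blast
      have [measurable]: "V i \<in> borel_measurable M" for i unfolding V_def[abs_def] by simp
      have [measurable]: "blinfun_apply (a i) \<in> borel_measurable borel" for i
        by (intro borel_measurable_continuous_onI linear_continuous_on blinfun.bounded_linear_right)
      have Yq: "integrable M (\<lambda>x. norm (Y i x) powr q)" for i
        unfolding Y_def by (rule orth_projection_contraction(1)[OF Z q0(1)])
      have Ym: "(\<integral>x. norm (Y i x) powr q \<partial>M) \<le> bq * 2 powr q * mq" for i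
      proof -
        have "(\<integral>x. norm (Y i x) powr q \<partial>M) \<le> bq * (\<integral>x. norm (g n (X i x)) powr q \<partial>M)"
          unfolding Y_def bq_def by (rule orth_projection_contraction(2)[OF Z q0(1)])
        also have "(\<integral>x. norm (g n (X i x)) powr q \<partial>M) = (\<integral>x. norm (g n (X 1 x)) powr q \<partial>M)"
          by (rule integral_X(1)) simp
        also have "\<dots> \<le> (\<integral>x. 2 powr q * (norm (X 1 x) powr q * indicator {..R} (norm (X 1 x))) \<partial>M)"
        proof (rule integral_mono)
          have "simple_function M (\<lambda>x. norm (g n (X 1 x)) powr q)"
            by (rule simple_function_compose1[OF Z])
          then show "integrable M (\<lambda>x. norm (g n (X 1 x)) powr q)" by (rule simple_function_integrable)
          show "integrable M (\<lambda>x. 2 powr q * (norm (X 1 x) powr q * indicator {..R} (norm (X 1 x))))"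
            using mq_int by (rule integrable_mult_right)
          fix x
          have "norm (g n (X 1 x)) powr q \<le> (2 * norm (f (X 1 x))) powr q"
            using q0 by (intro powr_mono2 gle) auto
          then show "norm (g n (X 1 x)) powr q \<le> 2 powr q * (norm (X 1 x) powr q * indicator {..R} (norm (X 1 x)))"
            using q0 by (auto simp: f_def powr_mult indicator_def)
        qed
        also have "\<dots> = 2 powr q * mq" by (simp add: mq_def)
        finally show ?thesis by (simp add: bq_def mult_ac)
      qed
      have diff_int: "integrable M (\<lambda>x. norm (X i x - g n (X i x)) powr p)" for i
        using integral_X(2)[of "\<lambda>x. norm (x - g n x) powr p" i] e_int by simp
      have Vp: "integrable M (\<lambda>x. norm (V i x) powr p)" for i
        unfolding V_def Y_def by (rule diff_orth_projection_contraction(1)[OF Z p0(1) diff_int])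
      have Vm: "(\<integral>x. norm (V i x) powr p \<partial>M) \<le> bp * e n" for i
        using diff_orth_projection_contraction(2)[OF Z p0(1) diff_int, of i]
          integral_X(1)[of "\<lambda>x. norm (x - g n x) powr p" i]
        by (simp add: V_def Y_def bp_def e_def)
      define U1 where "U1 x = (\<Sum>i\<in>J. blinfun_apply (a i) (Y i x))" for x
      define U2 where "U2 x = (\<Sum>i\<in>J. blinfun_apply (a i) (V i x))" for x
      have [measurable]: "U1 \<in> borel_measurable M" "U2 \<in> borel_measurable M"
        unfolding U1_def[abs_def] U2_def[abs_def] by measurable
      have U: "(\<Sum>i\<in>J. blinfun_apply (a i) (X i x)) = U1 x + U2 x" for x
        by (simp add: U1_def U2_def V_def blinfun.diff_right sum_subtractf)
      have U1: "integrable M (\<lambda>x. norm (U1 x) powr q)"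
        "(\<integral>x. norm (U1 x) powr q \<partial>M) \<le> Cq * (\<Sum>i\<in>J. norm (a i) powr p) powr (q / p) * (bq * 2 powr q * mq)"
        unfolding U1_def using Cq(2)[OF Y Yq Ym J, of a] by auto
      have U2: "integrable M (\<lambda>x. norm (U2 x) powr p)"
        "(\<integral>x. norm (U2 x) powr p \<partial>M) \<le> Cp * (\<Sum>i\<in>J. norm (a i) powr p) powr (p / p) * (bp * e n)"
        unfolding U2_def using Cp(2)[OF V Vp Vm J, of a] by auto
      have mq0: "0 \<le> mq" and e0: "0 \<le> e n" by (auto simp: mq_def e_def)
      have cq: "(\<Sum>i\<in>J. norm (a i) powr p) powr (q / p) \<le> c powr q"
      proof -
        have "(\<Sum>i\<in>J. norm (a i) powr p) powr (q / p) \<le> (c powr p) powr (q / p)"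
          using p0 q0 by (intro powr_mono2 ac) (auto intro: sum_nonneg)
        then show ?thesis using p0 by (simp add: powr_powr)
      qed
      have cp: "(\<Sum>i\<in>J. norm (a i) powr p) powr (p / p) \<le> c powr p"
        using ac p0 by (simp add: sum_nonneg)
      have "prob {x \<in> space M. norm (\<Sum>i\<in>J. blinfun_apply (a i) (X i x)) > t}
          \<le> prob ({x \<in> space M. norm (U1 x) > t / 2} \<union> {x \<in> space M. norm (U2 x) > t / 2})"
      proof (rule finite_measure_mono)
        show "{x \<in> space M. norm (\<Sum>i\<in>J. blinfun_apply (a i) (X i x)) > t}
          \<subseteq> {x \<in> space M. norm (U1 x) > t / 2} \<union> {x \<in> space M. norm (U2 x) > t / 2}"
          unfolding U
        proof (safe, rule ccontr)
          fix x assume "t < norm (U1 x + U2 x)" "\<not> t / 2 < norm (U1 x)" "\<not> t / 2 < norm (U2 x)"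
          then show False using norm_triangle_ineq[of "U1 x" "U2 x"] by linarith
        qed
      qed simp
      also have "\<dots> \<le> prob {x \<in> space M. norm (U1 x) > t / 2} + prob {x \<in> space M. norm (U2 x) > t / 2}"
        by (intro measure_Un_le) auto
      also have "prob {x \<in> space M. norm (U1 x) > t / 2} \<le> (\<integral>x. norm (U1 x) powr q \<partial>M) / (t / 2) powr q"
        using t q0 by (intro prob_norm_gt_le U1) auto
      also have "\<dots> \<le> (Cq * c powr q * (bq * 2 powr q * mq)) / (t / 2) powr q"
        by (intro divide_right_mono order_trans[OF U1(2)] mult_right_mono mult_left_mono cq)
          (use Cq mq0 in \<open>auto simp: bq_def\<close>)
      also have "\<dots> = (Cq * bq * 2 powr q * 2 powr q) * ((c / t) powr q * mq)"
        using t c by (simp add: powr_divide)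
      also have "\<dots> \<le> C * ((c / t) powr q * mq)"
        using mq0 by (intro mult_right_mono) (auto simp: C_def)
      also have "prob {x \<in> space M. norm (U2 x) > t / 2} \<le> (\<integral>x. norm (U2 x) powr p \<partial>M) / (t / 2) powr p"
        using t p0 by (intro prob_norm_gt_le U2) auto
      also have "\<dots> \<le> (Cp * c powr p * (bp * e n)) / (t / 2) powr p"
        by (intro divide_right_mono order_trans[OF U2(2)] mult_right_mono mult_left_mono cp)
          (use Cp e0 in \<open>auto simp: bp_def\<close>)
      also have "\<dots> = (Cp * bp * 2 powr p) * ((c / t) powr p * e n)"
        using t c by (simp add: powr_divide)
      also have "\<dots> \<le> C * ((c / t) powr p * e n)"
        using e0 by (intro mult_right_mono) (auto simp: C_def)
      finally show ?thesis by (simp add: algebra_simps)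
    qed
    have "(\<lambda>n. C * ((c / t) powr q * mq + (c / t) powr p * e n))
        \<longlonglongrightarrow> C * ((c / t) powr q * mq + (c / t) powr p * mp)"
      by (intro tendsto_intros e_lim)
    then have "prob {x \<in> space M. norm (\<Sum>i\<in>J. blinfun_apply (a i) (X i x)) > t}
        \<le> C * ((c / t) powr q * mq + (c / t) powr p * mp)"
      by (rule LIMSEQ_le_const) (use key in auto)
    then show "prob {x \<in> space M. norm (\<Sum>i\<in>J. blinfun_apply (a i) (X i x)) > t} \<le>
         C * ((c / t) powr q * (\<integral>x. norm (X 1 x) powr q * indicator {..R} (norm (X 1 x)) \<partial>M)
            + (c / t) powr p * (\<integral>x. norm (X 1 x) powr p * indicator {R<..} (norm (X 1 x)) \<partial>M))"
      by (simp add: mq_def mp_def)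
  qed
qed

end

section \<open>Sums in \<open>L\<^sup>p\<close>\<close>

lemma summable_on_finite_tail:
  fixes b :: "'i \<Rightarrow> real"
  assumes b: "b summable_on UNIV" and e: "0 < e"
  obtains I where "finite I" "\<And>J. finite J \<Longrightarrow> J \<inter> I = {} \<Longrightarrow> (\<Sum>i\<in>J. b i) \<le> e"
proof -
  obtain t where "(b has_sum t) UNIV" using b by (auto simp: summable_on_def)
  then have "eventually (\<lambda>J. dist (sum b J) t < e / 2) (finite_subsets_at_top UNIV)"
    using e unfolding has_sum_def by (intro tendstoD) auto
  then obtain I where I: "finite I" "\<And>J. finite J \<Longrightarrow> I \<subseteq> J \<Longrightarrow> dist (sum b J) t < e / 2"
    by (auto simp: eventually_finite_subsets_at_top)
  show thesis
  proof (rule that[OF I(1)])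
    fix J :: "'i set" assume J: "finite J" "J \<inter> I = {}"
    have "sum b (J \<union> I) = sum b J + sum b I" using J I(1) by (intro sum.union_disjoint)
    moreover have "dist (sum b (J \<union> I)) t < e / 2" "dist (sum b I) t < e / 2"
      using I J by auto
    ultimately show "sum b J \<le> e" by (simp add: dist_real_def abs_if split: if_splits)
  qed
qed

context prob_space
begin

lemma expectation_norm_powr_le:
  fixes f :: "'a \<Rightarrow> 'b::{banach, second_countable_topology}"
  assumes f: "f \<in> borel_measurable M" and p: "1 \<le> p" and fp: "integrable M (\<lambda>x. norm (f x) powr p)"
  shows "(\<integral>x. norm (f x) \<partial>M) powr p \<le> (\<integral>x. norm (f x) powr p \<partial>M)"
proof -
  have "integrable M (\<lambda>x. norm (f x))"
    using integrable_if_powr_integrable[OF equivalent_norm_norm p f fp] by simp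
  then have "\<bar>\<integral>x. norm (f x) \<partial>M\<bar> powr p \<le> (\<integral>x. \<bar>norm (f x)\<bar> powr p \<partial>M)"
    using fp by (intro jensens_inequality[where I = UNIV] convex_on_abs_powr p) auto
  then show ?thesis by simp
qed

text \<open>The partial sums form a Cauchy net in \<open>L\<^sup>p\<close>. The limit is
  constructed along a sequence of finite index sets that exhaust the sum of \<open>b\<close>,
  where a subsequence converges almost everywhere; Fatou's lemma then bounds the distance of every
  larger partial sum from the limit.\<close>

lemma has_Lp_sum_ex:
  fixes Y :: "'i \<Rightarrow> 'a \<Rightarrow> 'b::{banach, second_countable_topology}"
  assumes p: "1 \<le> p" and Ym[measurable]: "\<And>i. Y i \<in> borel_measurable M"
    and int: "\<And>J. finite J \<Longrightarrow> integrable M (\<lambda>x. norm (\<Sum>i\<in>J. Y i x) powr p)"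
    and bound: "\<And>J. finite J \<Longrightarrow> (\<integral>x. norm (\<Sum>i\<in>J. Y i x) powr p \<partial>M) \<le> (\<Sum>i\<in>J. b i)"
    and b: "b summable_on UNIV"
  shows "\<exists>S. has_Lp_sum M p Y S"
proof -
  define P where "P J x = (\<Sum>i\<in>J. Y i x)" for J x
  have Pm[measurable]: "P J \<in> borel_measurable M" for J unfolding P_def[abs_def] by measurable
  have Pint: "integrable M (\<lambda>x. norm (P J x) powr p)" if "finite J" for J
    using int[OF that] by (simp add: P_def)
  define \<delta> where "\<delta> k = (1/2 :: real) ^ k" for k :: nat
  have \<delta>0: "0 < \<delta> k" for k by (simp add: \<delta>_def)
  have "\<exists>I. \<forall>k. finite (I k) \<and> (\<forall>J. finite J \<longrightarrow> J \<inter> I k = {} \<longrightarrow> (\<Sum>i\<in>J. b i) \<le> \<delta> k)"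
    by (intro choice allI) (metis summable_on_finite_tail[OF b \<delta>0])
  then obtain I where I: "\<And>k. finite (I k)"
    "\<And>k J. finite J \<Longrightarrow> J \<inter> I k = {} \<Longrightarrow> (\<Sum>i\<in>J. b i) \<le> \<delta> k" by blast
  \<comment> \<open>The union makes the sets increasing, so that \<open>A n\<close> contains
    \<open>I k\<close> for all \<open>k \<le> n\<close>.\<close>
  define A where "A n = (\<Union>k\<le>n. I k)" for n
  have finA: "finite (A n)" for n using I(1) by (simp add: A_def)
  have IA: "I k \<subseteq> A n" if "k \<le> n" for k n using that by (auto simp: A_def)
  have close: "integrable M (\<lambda>x. norm (P J x - P J' x) powr p)"
    "(\<integral>x. norm (P J x - P J' x) powr p \<partial>M) \<le> 2 powr p * (2 * \<delta> k)"
    if J: "finite J" "I k \<subseteq> J" and J': "finite J'" "I k \<subseteq> J'" for J J' k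
  proof -
    have eq: "P J x - P J' x = P (J - J') x + - P (J' - J) x" for x
    proof -
      have "P J x = P (J - J') x + P (J \<inter> J') x" "P J' x = P (J' - J) x + P (J \<inter> J') x"
        unfolding P_def using J(1) J'(1)
        by (subst sum.union_disjoint[symmetric]; (auto intro!: sum.cong)[1]; fastforce?)+
      then show ?thesis by simp
    qed
    have le: "norm (P J x - P J' x) powr p
        \<le> 2 powr p * (norm (P (J - J') x) powr p + norm (P (J' - J) x) powr p)" for x
    proof -
      have "norm (P J x - P J' x) powr p \<le> (norm (P (J - J') x) + norm (P (J' - J) x)) powr p"
        unfolding eq using p norm_triangle_ineq[of "P (J - J') x" "- P (J' - J) x"]
        by (intro powr_mono2) auto
      then show ?thesis using powr_add_le[OF norm_ge_zero norm_ge_zero p] by (meson order_trans)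
    qed
    have i: "integrable M (\<lambda>x. norm (P (J - J') x) powr p)" "integrable M (\<lambda>x. norm (P (J' - J) x) powr p)"
      using J J' by (auto intro: Pint)
    then have ib: "integrable M (\<lambda>x. 2 powr p * (norm (P (J - J') x) powr p + norm (P (J' - J) x) powr p))"
      by simp
    show di: "integrable M (\<lambda>x. norm (P J x - P J' x) powr p)"
      using le by (intro Bochner_Integration.integrable_bound[OF ib]) auto
    have "(\<integral>x. norm (P J x - P J' x) powr p \<partial>M)
        \<le> 2 powr p * ((\<integral>x. norm (P (J - J') x) powr p \<partial>M) + (\<integral>x. norm (P (J' - J) x) powr p \<partial>M))"
      using integral_mono[OF di ib le] i by simp
    also have "\<dots> \<le> 2 powr p * (\<delta> k + \<delta> k)"
    proof (intro mult_left_mono add_mono)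
      show "(\<integral>x. norm (P (J - J') x) powr p \<partial>M) \<le> \<delta> k"
        using bound[of "J - J'"] I(2)[of "J - J'" k] J J' unfolding P_def by force
      show "(\<integral>x. norm (P (J' - J) x) powr p \<partial>M) \<le> \<delta> k"
        using bound[of "J' - J"] I(2)[of "J' - J" k] J J' unfolding P_def by force
    qed simp
    finally show "(\<integral>x. norm (P J x - P J' x) powr p \<partial>M) \<le> 2 powr p * (2 * \<delta> k)" by simp
  qed
  define \<eta> where "\<eta> k = 2 powr p * (2 * \<delta> k)" for k
  have \<eta>0: "0 < \<eta> k" for k using \<delta>0 by (simp add: \<eta>_def)
  have \<eta>lim: "\<eta> \<longlonglongrightarrow> 0"
  proof -
    have "(\<lambda>k. 2 powr p * (2 * (1/2 :: real) ^ k)) \<longlonglongrightarrow> 2 powr p * (2 * 0)"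
      by (intro tendsto_intros LIMSEQ_realpow_zero) auto
    then show ?thesis by (simp add: \<eta>_def[abs_def] \<delta>_def)
  qed
  obtain \<rho> where \<rho>: "strict_mono \<rho>" "AE x in M. Cauchy (\<lambda>n. P (A (\<rho> n)) x)"
  proof (rule cauchy_L1_AE_cauchy_subseq[of M "\<lambda>n. P (A n)"])
    show "integrable M (P (A n))" for n
      by (rule integrable_if_powr_integrable[OF equivalent_norm_norm p Pm Pint[OF finA]])
    fix e :: real assume e: "0 < e"
    have "\<forall>\<^sub>F k in sequentially. \<eta> k < e powr p"
      using order_tendstoD(2)[OF \<eta>lim, of "e powr p"] e by simp
    then obtain k where k: "\<eta> k < e powr p" by (auto simp: eventually_sequentially)
    have "(LINT x|M. norm (P (A i) x - P (A j) x)) < e" if "i \<ge> k" "j \<ge> k" for i j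
    proof (rule ccontr)
      assume "\<not> (LINT x|M. norm (P (A i) x - P (A j) x)) < e"
      then have "e powr p \<le> (LINT x|M. norm (P (A i) x - P (A j) x)) powr p"
        using e p by (intro powr_mono2) auto
      also have "\<dots> \<le> (LINT x|M. norm (P (A i) x - P (A j) x) powr p)"
        using that by (intro expectation_norm_powr_le p close(1)[OF finA IA finA IA]) auto
      also have "\<dots> \<le> \<eta> k"
        unfolding \<eta>_def using that by (intro close(2) finA IA) auto
      finally show False using k by simp
    qed
    then show "\<exists>N. \<forall>i\<ge>N. \<forall>j\<ge>N. (LINT x|M. norm (P (A i) x - P (A j) x)) < e" by blast
  qed blast
  define T where "T n = P (A (\<rho> n))" for n
  have Tm[measurable]: "T n \<in> borel_measurable M" for n by (simp add: T_def)
  define S where "S x = lim (\<lambda>n. T n x)" for x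
  have Sm[measurable]: "S \<in> borel_measurable M" unfolding S_def[abs_def] by measurable
  have TS: "AE x in M. (\<lambda>n. T n x) \<longlonglongrightarrow> S x"
    using \<rho>(2) by eventually_elim (simp add: T_def S_def Cauchy_convergent_iff convergent_LIMSEQ_iff)
  have dist: "(\<integral>\<^sup>+ x. ennreal (norm (P J x - S x) powr p) \<partial>M) \<le> ennreal (\<eta> k)"
    if J: "finite J" "I k \<subseteq> J" for J k
  proof -
    have "(\<integral>\<^sup>+ x. ennreal (norm (P J x - S x) powr p) \<partial>M)
        = (\<integral>\<^sup>+ x. liminf (\<lambda>n. ennreal (norm (P J x - T n x) powr p)) \<partial>M)"
    proof (rule nn_integral_cong_AE)
      show "AE x in M. ennreal (norm (P J x - S x) powr p)
          = liminf (\<lambda>n. ennreal (norm (P J x - T n x) powr p))"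
        using TS
      proof eventually_elim
        case (elim x)
        have "(\<lambda>n. ennreal (norm (P J x - T n x) powr p)) \<longlonglongrightarrow> ennreal (norm (P J x - S x) powr p)"
          using p by (intro tendsto_ennrealI tendsto_powr2 tendsto_norm tendsto_diff elim tendsto_const) auto
        from lim_imp_Liminf[OF _ this] show ?case by simp
      qed
    qed
    also have "\<dots> \<le> liminf (\<lambda>n. \<integral>\<^sup>+ x. ennreal (norm (P J x - T n x) powr p) \<partial>M)"
      by (rule nn_integral_liminf) measurable
    also have "\<dots> \<le> liminf (\<lambda>n. ennreal (\<eta> k))"
    proof (rule Liminf_mono)
      show "\<forall>\<^sub>F n in sequentially. (\<integral>\<^sup>+ x. ennreal (norm (P J x - T n x) powr p) \<partial>M) \<le> ennreal (\<eta> k)"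
        using eventually_ge_at_top[of k]
      proof eventually_elim
        case (elim n)
        then have "I k \<subseteq> A (\<rho> n)" using seq_suble[OF \<rho>(1), of n] by (intro IA) simp
        then show ?case
          unfolding T_def \<eta>_def using close[OF J finA] by (subst nn_integral_eq_integral) (auto intro!: ennreal_leI)
      qed
    qed
    also have "\<dots> = ennreal (\<eta> k)" by (simp add: Liminf_const)
    finally show ?thesis .
  qed
  have "integrable M (\<lambda>x. norm (S x) powr p)"
  proof -
    have fin: "(\<integral>\<^sup>+ x. ennreal (norm (P (I 0) x - S x) powr p) \<partial>M) < \<infinity>"
      using dist[of "I 0" 0] I(1) by (simp add: order_le_less_trans ennreal_less_top)
    have d: "integrable M (\<lambda>x. norm (P (I 0) x - S x) powr p)"
      using fin by (intro integrableI_bounded) auto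
    then have "integrable M (\<lambda>x. norm (- (P (I 0) x - S x)) powr p)" by (simp only: norm_minus_cancel)
    from powr_integrable_add[OF equivalent_norm_norm p _ _ Pint[OF I(1)[of 0]] this]
    show ?thesis by simp
  qed
  moreover have "((\<lambda>J. \<integral>\<^sup>+ x. ennreal (norm (P J x - S x) powr p) \<partial>M) \<longlongrightarrow> 0) (finite_subsets_at_top UNIV)"
  proof (rule order_tendstoI)
    fix e :: ennreal assume "0 < e"
    have "(\<lambda>k. ennreal (\<eta> k)) \<longlonglongrightarrow> ennreal 0" by (intro tendsto_ennrealI \<eta>lim)
    then have "\<forall>\<^sub>F k in sequentially. ennreal (\<eta> k) < e"
      using \<open>0 < e\<close> by (intro order_tendstoD(2)[of _ 0]) simp_all
    then obtain k where k: "ennreal (\<eta> k) < e" by (auto simp: eventually_sequentially)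
    have "(\<integral>\<^sup>+ x. ennreal (norm (P J x - S x) powr p) \<partial>M) < e" if "finite J" "I k \<subseteq> J" for J
      using dist[OF that] k by (rule order_le_less_trans)
    then show "\<forall>\<^sub>F J in finite_subsets_at_top UNIV. (\<integral>\<^sup>+ x. ennreal (norm (P J x - S x) powr p) \<partial>M) < e"
      using I(1) by (auto simp: eventually_finite_subsets_at_top)
  qed simp
  ultimately show ?thesis
    using Sm unfolding has_Lp_sum_def P_def by blast
qed

lemma has_Lp_sum_tail_le:
  fixes Y :: "'i \<Rightarrow> 'a \<Rightarrow> 'b::{banach, second_countable_topology}"
  assumes S: "has_Lp_sum M p Y S" and p: "0 < p" and Ym[measurable]: "\<And>i. Y i \<in> borel_measurable M"
    and t: "0 < t" and B: "0 \<le> B"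
    and bound: "\<And>J. finite J \<Longrightarrow> prob {x \<in> space M. norm (\<Sum>i\<in>J. Y i x) > t} \<le> B"
  shows "prob {x \<in> space M. norm (S x) > 2 * t} \<le> B"
proof -
  have [measurable]: "S \<in> borel_measurable M" using S by (simp add: has_Lp_sum_def)
  define d where "d J = (\<integral>\<^sup>+ x. ennreal (norm ((\<Sum>i\<in>J. Y i x) - S x) powr p) \<partial>M)" for J
  have d: "(d \<longlongrightarrow> 0) (finite_subsets_at_top UNIV)" using S by (simp add: has_Lp_sum_def d_def[abs_def])
  have le: "emeasure M {x \<in> space M. norm (S x) > 2 * t} \<le> ennreal B + ennreal (1 / t powr p) * d J"
    if J: "finite J" for J
  proof -
    define U where "U x = (\<Sum>i\<in>J. Y i x)" for x
    have [measurable]: "U \<in> borel_measurable M" unfolding U_def[abs_def] by measurable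
    have "emeasure M {x \<in> space M. norm (S x) > 2 * t}
        \<le> emeasure M ({x \<in> space M. norm (U x) > t}
          \<union> {x \<in> space M. 1 \<le> ennreal (1 / t powr p) * ennreal (norm (U x - S x) powr p)})"
    proof (rule emeasure_mono)
      show "{x \<in> space M. norm (S x) > 2 * t} \<subseteq> {x \<in> space M. norm (U x) > t}
          \<union> {x \<in> space M. 1 \<le> ennreal (1 / t powr p) * ennreal (norm (U x - S x) powr p)}"
      proof
        fix x assume x: "x \<in> {x \<in> space M. norm (S x) > 2 * t}"
        have "1 \<le> ennreal (1 / t powr p) * ennreal (norm (U x - S x) powr p)" if "\<not> norm (U x) > t"
        proof -
          have "t \<le> norm (U x - S x)"
            using x that norm_triangle_ineq2[of "S x" "U x"] by (simp add: norm_minus_commute)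
          then have "t powr p \<le> norm (U x - S x) powr p" using t p by (intro powr_mono2) auto
          then have "1 \<le> (1 / t powr p) * norm (U x - S x) powr p" using t by (simp add: field_simps)
          then show ?thesis by (simp flip: ennreal_mult)
        qed
        then show "x \<in> {x \<in> space M. norm (U x) > t}
          \<union> {x \<in> space M. 1 \<le> ennreal (1 / t powr p) * ennreal (norm (U x - S x) powr p)}"
          using x by auto
      qed
    qed measurable
    also have "\<dots> \<le> emeasure M {x \<in> space M. norm (U x) > t}
        + emeasure M {x \<in> space M. 1 \<le> ennreal (1 / t powr p) * ennreal (norm (U x - S x) powr p)}"
      by (rule emeasure_subadditive) measurable
    also have "emeasure M {x \<in> space M. norm (U x) > t} \<le> ennreal B"
      using bound[OF J] by (simp add: emeasure_eq_measure U_def ennreal_leI)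
    also have "emeasure M {x \<in> space M. 1 \<le> ennreal (1 / t powr p) * ennreal (norm (U x - S x) powr p)}
        \<le> ennreal (1 / t powr p) * (\<integral>\<^sup>+ x. ennreal (norm (U x - S x) powr p) * indicator (space M) x \<partial>M)"
      using nn_integral_Markov_inequality[of "\<lambda>x. ennreal (norm (U x - S x) powr p)" "space M" M "ennreal (1 / t powr p)"]
      by simp
    also have "(\<integral>\<^sup>+ x. ennreal (norm (U x - S x) powr p) * indicator (space M) x \<partial>M) = d J"
      by (simp add: d_def U_def cong: nn_integral_cong)
    finally show ?thesis by (simp add: add_mono)
  qed
  have "((\<lambda>J. ennreal B + ennreal (1 / t powr p) * d J) \<longlongrightarrow> ennreal B + ennreal (1 / t powr p) * 0)
      (finite_subsets_at_top UNIV)"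
    by (intro tendsto_add tendsto_const ennreal_tendsto_cmult d) simp
  then have "emeasure M {x \<in> space M. norm (S x) > 2 * t} \<le> ennreal B + ennreal (1 / t powr p) * 0"
  proof (rule tendsto_lowerbound)
    show "\<forall>\<^sub>F J in finite_subsets_at_top UNIV.
        emeasure M {x \<in> space M. norm (S x) > 2 * t} \<le> ennreal B + ennreal (1 / t powr p) * d J"
      using le by (auto simp: eventually_finite_subsets_at_top)
  qed simp
  then show ?thesis using B by (simp add: emeasure_eq_measure)
qed

end

section \<open>Summation over the scales\<close>

text \<open>With \<open>u = (a / b) powr (s - p)\<close> and \<open>k = s / (s - p)\<close> this
  is Bernoulli's inequality \<open>1 - u powr k \<le> k * (1 - u)\<close>.\<close>

lemma powr_diff_mult_le:
  fixes a b s p :: real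
  assumes a: "0 \<le> a" "a \<le> b" and b: "0 < b" and s: "0 < p" "p < s"
  shows "(b powr s - a powr s) * (1 / b powr p) \<le> s / (s - p) * (b powr (s - p) - a powr (s - p))"
proof -
  define k where "k = s / (s - p)"
  have k: "1 \<le> k" using s by (simp add: k_def field_simps)
  define u where "u = (a / b) powr (s - p)"
  have u0: "0 \<le> u" by (simp add: u_def)
  have uk: "u powr k = (a / b) powr s" using s by (simp add: u_def k_def powr_powr)
  have bern: "1 - u powr k \<le> k * (1 - u)"
  proof (cases "u = 0")
    case False
    then have "(u powr k) powr (1 / k) * 1 powr (1 - 1 / k) \<le> 1 / k * u powr k + (1 - 1 / k) * 1"
      using u0 k by (intro Youngs_inequality_0) auto
    then have "u \<le> 1 / k * u powr k + (1 - 1 / k)" using u0 k by (simp add: powr_powr)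
    then have "k * u \<le> k * (1 / k * u powr k + (1 - 1 / k))" using k by (intro mult_left_mono) auto
    also have "\<dots> = u powr k + k - 1" using k by (simp add: field_simps)
    finally show ?thesis by (simp add: algebra_simps)
  qed (use k in simp)
  have 1: "(b powr s - a powr s) * (1 / b powr p) = b powr (s - p) * (1 - u powr k)"
    unfolding uk using a b by (simp add: powr_divide powr_diff field_simps)
  have 2: "b powr (s - p) - a powr (s - p) = b powr (s - p) * (1 - u)"
    unfolding u_def using a b by (simp add: powr_divide field_simps)
  show ?thesis
    unfolding 1 2 k_def[symmetric] using mult_left_mono[OF bern, of "b powr (s - p)"] by (simp add: mult_ac)
qed

definition truncated_powers :: "real \<Rightarrow> real \<Rightarrow> real \<Rightarrow> real \<Rightarrow> real" where
  "truncated_powers p q R x =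
     x powr q / R powr q * indicator {..R} x + x powr p / R powr p * indicator {R<..} x"

lemma truncated_powers_nonneg: "0 \<le> truncated_powers p q R x"
  by (simp add: truncated_powers_def)

text \<open>The partial sums are dominated by an explicit function \<open>\<Psi>\<close> of the
  current scale. Below \<open>x\<close> it grows like \<open>\<rho> powr (s - p)\<close>, above
  \<open>x\<close> it approaches its supremum like \<open>- 1 / \<rho> powr s\<close>, and the
  term of each scale is at most the increment of \<open>\<Psi>\<close>. The exponent \<open>2 *
  s\<close> is chosen because the increment above \<open>x\<close> then becomes the difference of
  two reciprocals.\<close>

lemma sum_weighted_truncated_powers_le:
  fixes R :: "nat \<Rightarrow> real"
  assumes p: "0 < p" "p < s" and x: "0 \<le> x"
    and R0: "R 0 = 0" and Rpos: "\<And>n. 1 \<le> n \<Longrightarrow> 0 < R n" and Rmono: "mono_on {1..} R"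
    and I: "finite I" "I \<subseteq> {1..}"
  shows "(\<Sum>n\<in>I. (R n powr s - R (n - 1) powr s) * truncated_powers p (2 * s) (R n) x)
    \<le> (s / (s - p) + 2) * x powr s"
proof (cases "x = 0")
  case True
  then show ?thesis using p by (simp add: truncated_powers_def)
next
  case False
  then have x: "0 < x" using x by simp
  have s: "0 < s" using p by simp
  define k where "k = s / (s - p)"
  have k: "0 \<le> k" using p s by (simp add: k_def)
  have step: "R n \<le> R (Suc n)" for n
    using R0 Rpos[of "Suc n"] mono_onD[OF Rmono, of n "Suc n"] by (cases "n = 0") auto
  have nn: "0 \<le> R n" for n using R0 Rpos[of n] by (cases "n = 0") auto
  define \<phi> where "\<phi> = (\<lambda>\<rho>. truncated_powers p (2 * s) \<rho> x)"
  define \<Psi> where "\<Psi> \<rho> = (if \<rho> < x then k * (x powr p * \<rho> powr (s - p))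
    else (k + 2) * x powr s - x powr s * x powr s / \<rho> powr s)" for \<rho>
  have below: "k * (x powr p * \<rho> powr (s - p)) \<le> k * x powr s" if "0 \<le> \<rho>" "\<rho> < x" for \<rho>
  proof (intro mult_left_mono k)
    have "x powr p * \<rho> powr (s - p) \<le> x powr p * x powr (s - p)"
      using that p by (intro mult_left_mono powr_mono2) auto
    also have "\<dots> = x powr s" using x by (simp flip: powr_add)
    finally show "x powr p * \<rho> powr (s - p) \<le> x powr s" .
  qed
  have \<Psi>_step: "\<Psi> a + (b powr s - a powr s) * \<phi> b \<le> \<Psi> b" if ab: "0 \<le> a" "a \<le> b" "0 < b" for a b
  proof -
    have b2: "b powr (2 * s) = b powr s * b powr s" and x2: "x powr (2 * s) = x powr s * x powr s"
      by (simp_all flip: powr_add)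
    have bs: "0 < b powr s" and xs: "0 < x powr s" using ab x by auto
    consider "b < x" | "a < x" "x \<le> b" | "x \<le> a" by linarith
    then show ?thesis
    proof cases
      case 1
      have "(b powr s - a powr s) * \<phi> b = x powr p * ((b powr s - a powr s) * (1 / b powr p))"
        using 1 by (simp add: \<phi>_def truncated_powers_def)
      also have "\<dots> \<le> x powr p * (k * (b powr (s - p) - a powr (s - p)))"
        unfolding k_def using ab p by (intro mult_left_mono powr_diff_mult_le) auto
      finally show ?thesis using 1 ab by (simp add: \<Psi>_def algebra_simps)
    next
      case 2
      have "(b powr s - a powr s) * \<phi> b \<le> b powr s * \<phi> b"
        by (intro mult_right_mono) (auto simp: \<phi>_def truncated_powers_nonneg)
      also have "\<dots> = x powr s * x powr s / b powr s"
        using 2 bs by (simp add: \<phi>_def truncated_powers_def b2 x2)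
      finally have 3: "(b powr s - a powr s) * \<phi> b \<le> x powr s * x powr s / b powr s" .
      have "x powr s \<le> b powr s" using 2 x s by (intro powr_mono2) auto
      then have "x powr s * x powr s / b powr s \<le> x powr s"
        using bs xs by (simp add: divide_le_eq mult_left_mono)
      then show ?thesis using 3 2 below[OF ab(1) 2(1)] by (simp add: \<Psi>_def algebra_simps)
    next
      case 3
      have as: "0 < a powr s" using 3 x by simp
      have le: "a powr s \<le> b powr s" using ab s by (intro powr_mono2) auto
      have "(b powr s - a powr s) * \<phi> b = x powr s * x powr s * ((b powr s - a powr s) / (b powr s * b powr s))"
        using 3 ab by (simp add: \<phi>_def truncated_powers_def b2 x2)
      also have "\<dots> \<le> x powr s * x powr s * ((b powr s - a powr s) / (a powr s * b powr s))"
        using le as bs by (intro mult_left_mono divide_left_mono mult_right_mono mult_pos_pos) auto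
      also have "(b powr s - a powr s) / (a powr s * b powr s) = 1 / a powr s - 1 / b powr s"
        using as bs by (simp add: field_simps)
      finally show ?thesis using 3 ab by (simp add: \<Psi>_def right_diff_distrib)
    qed
  qed
  have tele: "(\<Sum>n\<in>{1..n}. (R n powr s - R (n - 1) powr s) * \<phi> (R n)) \<le> \<Psi> (R n)" for n
  proof (induction n)
    case 0
    then show ?case using R0 x p by (simp add: \<Psi>_def)
  next
    case (Suc n)
    then show ?case using \<Psi>_step[OF nn[of n] step[of n] Rpos[of "Suc n"]] by simp
  qed
  obtain m where m: "I \<subseteq> {1..m}"
    using I finite_nat_set_iff_bounded_le[of I] by (metis atLeastAtMost_iff atLeast_iff subset_eq)
  have "(\<Sum>n\<in>I. (R n powr s - R (n - 1) powr s) * \<phi> (R n))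
      \<le> (\<Sum>n\<in>{1..m}. (R n powr s - R (n - 1) powr s) * \<phi> (R n))"
  proof (rule sum_mono2[OF _ m])
    fix n assume "n \<in> {1..m} - I"
    then have "R (n - 1) powr s \<le> R n powr s"
      using step[of "n - 1"] nn s by (intro powr_mono2) auto
    then show "0 \<le> (R n powr s - R (n - 1) powr s) * \<phi> (R n)"
      by (simp add: \<phi>_def truncated_powers_nonneg)
  qed simp
  also have "\<dots> \<le> \<Psi> (R m)" by (rule tele)
  also have "\<dots> \<le> (k + 2) * x powr s"
    using below[OF nn, of m] by (auto simp: \<Psi>_def algebra_simps intro: order_trans add_increasing2)
  finally show ?thesis by (simp add: \<phi>_def k_def)
qed

context identically_distributed_orthomartingale
begin

lemma weighted_sum_exists:
  fixes a :: "int ^ 'd \<Rightarrow> ('b \<Rightarrow>\<^sub>L 'b)"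
  assumes r: "r_smooth TYPE('b) r" "r \<le> 2" and p: "1 < p" "p < r"
    and Xp: "integrable M (\<lambda>x. norm (X 1 x) powr p)"
    and a: "(\<lambda>i. norm (a i) powr p) summable_on UNIV"
  shows "\<exists>S. has_Lp_sum M p (\<lambda>i x. a i (X i x)) S"
proof -
  obtain C where C: "0 \<le> C"
    "\<And>(a :: int ^ 'd \<Rightarrow> ('b \<Rightarrow>\<^sub>L 'b)) Y J m. orth_differences M F Y \<Longrightarrow>
       (\<And>i. integrable M (\<lambda>x. norm (Y i x) powr p)) \<Longrightarrow>
       (\<And>i. (\<integral>x. norm (Y i x) powr p \<partial>M) \<le> m) \<Longrightarrow> finite J \<Longrightarrow>
       integrable M (\<lambda>x. norm (\<Sum>i\<in>J. blinfun_apply (a i) (Y i x)) powr p) \<and>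
       (\<integral>x. norm (\<Sum>i\<in>J. blinfun_apply (a i) (Y i x)) powr p \<partial>M)
         \<le> C * (\<Sum>i\<in>J. norm (a i) powr p) powr (p / p) * m"
    by (rule orth_sum_moment_bound[OF r p order_refl]) blast
  define m where "m = (\<integral>x. norm (X 1 x) powr p \<partial>M)"
  have Xi: "integrable M (\<lambda>x. norm (X i x) powr p)" for i
    using integral_X(2)[of "\<lambda>x. norm x powr p" i] Xp by simp
  have Xm: "(\<integral>x. norm (X i x) powr p \<partial>M) \<le> m" for i
    using integral_X(1)[of "\<lambda>x. norm x powr p" i] by (simp add: m_def)
  note bound = C(2)[OF X_orth_differences Xi Xm, of _ a]
  show ?thesis
  proof (rule has_Lp_sum_ex)
    show "1 \<le> p" using p by simp
    show "(\<lambda>x. blinfun_apply (a i) (X i x)) \<in> borel_measurable M" for i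
      using measurable_compose[OF X_measurable borel_measurable_continuous_onI[OF
          linear_continuous_on[OF blinfun.bounded_linear_right]]] by blast
    show "integrable M (\<lambda>x. norm (\<Sum>i\<in>J. blinfun_apply (a i) (X i x)) powr p)" if "finite J" for J
      using bound[OF that] by blast
    show "(\<integral>x. norm (\<Sum>i\<in>J. blinfun_apply (a i) (X i x)) powr p \<partial>M) \<le> (\<Sum>i\<in>J. C * m * norm (a i) powr p)"
      if "finite J" for J
    proof -
      have "(\<Sum>i\<in>J. norm (a i) powr p) powr (p / p) = (\<Sum>i\<in>J. norm (a i) powr p)"
        using p by (simp add: sum_nonneg)
      then show ?thesis
        using bound[OF that] by (simp add: sum_distrib_left[symmetric] mult_ac)
    qed
    show "(\<lambda>i. C * m * norm (a i) powr p) summable_on UNIV"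
      by (rule summable_on_cmult_right[OF a])
  qed
qed

lemma weighted_series_tail_bound:
  assumes r: "r_smooth TYPE('b) r" "r \<le> 2" and p: "1 < p" "p < r" and q: "p \<le> q"
    and Xp: "integrable M (\<lambda>x. norm (X 1 x) powr p)" and \<epsilon>: "0 < \<epsilon>"
  obtains C where "0 \<le> C"
    "\<And>(a :: int ^ 'd \<Rightarrow> ('b \<Rightarrow>\<^sub>L 'b)) S R. (\<lambda>i. norm (a i) powr p) summable_on UNIV \<Longrightarrow>
       has_Lp_sum M p (\<lambda>i x. blinfun_apply (a i) (X i x)) S \<Longrightarrow> 0 < R \<Longrightarrow>
       prob {x \<in> space M. norm (S x) > \<epsilon> * lp_coeff_norm p a * R}
         \<le> C * (\<integral>x. truncated_powers p q R (norm (X 1 x)) \<partial>M)"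
proof -
  obtain C where C: "0 \<le> C"
    "\<And>(a :: int ^ 'd \<Rightarrow> ('b \<Rightarrow>\<^sub>L 'b)) J c t R. finite J \<Longrightarrow> 0 < t \<Longrightarrow> 0 < R \<Longrightarrow> 0 \<le> c \<Longrightarrow>
       (\<Sum>i\<in>J. norm (a i) powr p) \<le> c powr p \<Longrightarrow>
       prob {x \<in> space M. norm (\<Sum>i\<in>J. blinfun_apply (a i) (X i x)) > t} \<le>
         C * ((c / t) powr q * (\<integral>x. norm (X 1 x) powr q * indicator {..R} (norm (X 1 x)) \<partial>M)
            + (c / t) powr p * (\<integral>x. norm (X 1 x) powr p * indicator {R<..} (norm (X 1 x)) \<partial>M))"
    by (rule weighted_sum_tail_bound[OF r p q Xp]) blast
  have p0: "0 < p" and q0: "0 < q" using p q by auto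
  define D where "D = max ((2 / \<epsilon>) powr q) ((2 / \<epsilon>) powr p)"
  show thesis
  proof (rule that[of "C * D"])
    show "0 \<le> C * D" using C(1) by (simp add: D_def le_max_iff_disj)
    fix a :: "int ^ 'd \<Rightarrow> ('b \<Rightarrow>\<^sub>L 'b)" and S :: "'a \<Rightarrow> 'b" and R :: real
    assume a: "(\<lambda>i. norm (a i) powr p) summable_on UNIV"
      and S: "has_Lp_sum M p (\<lambda>i x. blinfun_apply (a i) (X i x)) S" and R: "0 < R"
    have [measurable]: "S \<in> borel_measurable M" using S by (simp add: has_Lp_sum_def)
    define c where "c = lp_coeff_norm p a"
    have cp: "c powr p = (\<Sum>\<^sub>\<infinity>i. norm (a i) powr p)"
      using p0 by (simp add: c_def lp_coeff_norm_def powr_powr infsum_nonneg)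
    have ac: "(\<Sum>i\<in>J. norm (a i) powr p) \<le> c powr p" if "finite J" for J
      unfolding cp using a that by (intro finite_sum_le_infsum) auto
    have c0: "0 \<le> c" by (simp add: c_def lp_coeff_norm_def)
    define T where "T = (\<integral>x. truncated_powers p q R (norm (X 1 x)) \<partial>M)"
    have T0: "0 \<le> T" by (simp add: T_def truncated_powers_nonneg)
    define mq where "mq = (\<integral>x. norm (X 1 x) powr q * indicator {..R} (norm (X 1 x)) \<partial>M)"
    define mp where "mp = (\<integral>x. norm (X 1 x) powr p * indicator {R<..} (norm (X 1 x)) \<partial>M)"
    have mq_int: "integrable M (\<lambda>x. norm (X 1 x) powr q * indicator {..R} (norm (X 1 x)))"
      using q0 R by (intro integrable_const_bound[where B = "R powr q"])
        (auto simp: indicator_def intro!: powr_mono2)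
    have mp_int: "integrable M (\<lambda>x. norm (X 1 x) powr p * indicator {R<..} (norm (X 1 x)))"
      by (rule Bochner_Integration.integrable_bound[OF Xp]) (auto simp: indicator_def)
    have T: "T = mq / R powr q + mp / R powr p"
    proof -
      have "T = (\<integral>x. norm (X 1 x) powr q * indicator {..R} (norm (X 1 x)) / R powr q
          + norm (X 1 x) powr p * indicator {R<..} (norm (X 1 x)) / R powr p \<partial>M)"
        by (simp add: T_def truncated_powers_def)
      also have "\<dots> = mq / R powr q + mp / R powr p"
        using mq_int mp_int by (subst Bochner_Integration.integral_add) (simp_all add: mq_def mp_def)
      finally show ?thesis .
    qed
    have mnn: "0 \<le> mq" "0 \<le> mp" by (auto simp: mq_def mp_def)
    show "prob {x \<in> space M. norm (S x) > \<epsilon> * lp_coeff_norm p a * R}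
         \<le> C * D * (\<integral>x. truncated_powers p q R (norm (X 1 x)) \<partial>M)"
      unfolding c_def[symmetric] T_def[symmetric]
    \<comment> \<open>For \<open>c = 0\<close> the threshold is zero and the tail bound at a
      positive level says nothing; all operators vanish, and so does \<open>S\<close>.\<close>
    proof (cases "c = 0")
      case True
      have a0: "a i = 0" for i
        using ac[of "{i}"] True p0 by simp
      have "((\<lambda>J. \<integral>\<^sup>+ x. ennreal (norm (S x) powr p) \<partial>M) \<longlongrightarrow> 0) (finite_subsets_at_top (UNIV :: (int ^ 'd) set))"
        using S by (simp add: has_Lp_sum_def a0)
      then have "(\<integral>\<^sup>+ x. ennreal (norm (S x) powr p) \<partial>M) = 0"
        by (simp add: tendsto_const_iff)
      then have "AE x in M. ennreal (norm (S x) powr p) = 0"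
        by (subst (asm) nn_integral_0_iff_AE) auto
      then have "AE x in M. \<not> norm (S x) > 0" by eventually_elim (simp add: ennreal_eq_0_iff)
      then have "prob {x \<in> space M. norm (S x) > 0} = 0"
        by (subst prob_eq_0) auto
      then show "prob {x \<in> space M. norm (S x) > \<epsilon> * c * R} \<le> C * D * T"
        using True C(1) T0 by (simp add: D_def le_max_iff_disj)
    next
      case False
      then have c: "0 < c" using c0 by simp
      \<comment> \<open>Half of the threshold is left to the distance between \<open>S\<close>
        and its partial sums.\<close>
      define t where "t = \<epsilon> * c * R / 2"
      have t: "0 < t" using c \<epsilon> R by (simp add: t_def)
      have ct: "c / t = (2 / \<epsilon>) / R" using c \<epsilon> R by (simp add: t_def)
      have "prob {x \<in> space M. norm (S x) > 2 * t} \<le> C * ((c / t) powr q * mq + (c / t) powr p * mp)"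
      proof (rule has_Lp_sum_tail_le[OF S p0 _ t])
        show "(\<lambda>x. blinfun_apply (a i) (X i x)) \<in> borel_measurable M" for i
          using measurable_compose[OF X_measurable borel_measurable_continuous_onI[OF
              linear_continuous_on[OF blinfun.bounded_linear_right]]] by blast
        show "0 \<le> C * ((c / t) powr q * mq + (c / t) powr p * mp)"
          using C(1) mnn by simp
        show "prob {x \<in> space M. norm (\<Sum>i\<in>J. blinfun_apply (a i) (X i x)) > t}
            \<le> C * ((c / t) powr q * mq + (c / t) powr p * mp)" if "finite J" for J
          unfolding mq_def mp_def by (rule C(2)[OF that t R c0 ac[OF that]])
      qed
      also have "\<dots> = C * ((2 / \<epsilon>) powr q * (mq / R powr q) + (2 / \<epsilon>) powr p * (mp / R powr p))"
        unfolding ct using \<epsilon> R by (simp add: powr_divide powr_mult)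
      also have "\<dots> \<le> C * (D * (mq / R powr q) + D * (mp / R powr p))"
        using C(1) mnn by (intro mult_left_mono add_mono mult_right_mono) (auto simp: D_def)
      also have "\<dots> = C * D * T" by (simp add: T algebra_simps)
      finally show "prob {x \<in> space M. norm (S x) > \<epsilon> * c * R} \<le> C * D * T"
        by (simp add: t_def)
    qed
  qed
qed

lemma truncated_powers_integrable:
  assumes "0 \<le> p" "0 \<le> q" "0 < R" and Xp: "integrable M (\<lambda>x. norm (X 1 x) powr p)"
  shows "integrable M (\<lambda>x. truncated_powers p q R (norm (X 1 x)))"
proof -
  have i: "integrable M (\<lambda>x. 1 + norm (X 1 x) powr p / R powr p)" using Xp by auto
  have le: "truncated_powers p q R y \<le> 1 + y powr p / R powr p" if "0 \<le> y" for y
  proof (cases "y \<le> R")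
    case True
    then have "y powr q \<le> R powr q" using that assms by (intro powr_mono2) auto
    then have "y powr q / R powr q \<le> 1" using assms(3) by (simp add: divide_le_eq)
    then have "y powr q / R powr q \<le> 1 + y powr p / R powr p" by (rule order_trans) simp
    then show ?thesis using True by (simp add: truncated_powers_def)
  qed (use assms in \<open>simp add: truncated_powers_def\<close>)
  have "(\<lambda>x. truncated_powers p q R (norm (X 1 x))) \<in> borel_measurable M"
    unfolding truncated_powers_def by measurable
  then show ?thesis
    using le by (intro Bochner_Integration.integrable_bound[OF i]) (auto simp: truncated_powers_nonneg abs_of_nonneg)
qed

end

theorem theorem2p7:
  fixes M :: "'a measure"
    and A :: "nat \<Rightarrow> int ^ 'd \<Rightarrow> ('b::{banach, second_countable_topology} \<Rightarrow>\<^sub>L 'b)"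
    and X :: "int ^ 'd \<Rightarrow> 'a \<Rightarrow> 'b"
    and r p s :: real
  assumes "prob_space M"
    and "1 < r" and "r \<le> 2" and "r_smooth TYPE('b) r"
    and "1 < p" and "p < r"
    and "\<And>n. n \<ge> 1 \<Longrightarrow> (\<lambda>i. norm (A n i) powr p) summable_on UNIV"
    and "orthomartingale_difference M X"
    and "identically_distributed M X"
    and "p < s" and "integrable M (\<lambda>\<omega>. norm (X 1 \<omega>) powr s)"
  shows "(\<forall>n\<ge>1. \<exists>S. has_Lp_sum M p (\<lambda>i \<omega>. A n i (X i \<omega>)) S) \<and>
    (\<forall>(S :: nat \<Rightarrow> 'a \<Rightarrow> 'b) (R :: nat \<Rightarrow> real) (\<epsilon> :: real).
       (\<forall>n\<ge>1. has_Lp_sum M p (\<lambda>i \<omega>. A n i (X i \<omega>)) (S n)) \<longrightarrow>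
       \<epsilon> > 0 \<longrightarrow>
       R 0 = 0 \<longrightarrow> (\<forall>n\<ge>1. R n > 0) \<longrightarrow> mono_on {1..} R \<longrightarrow> filterlim R at_top sequentially \<longrightarrow>
       (\<lambda>n. (R n powr s - R (n - 1) powr s) *
            measure M {\<omega> \<in> space M. norm (S n \<omega>) > \<epsilon> * lp_coeff_norm p (A n) * R n})
         summable_on {1..})"
proof -
  obtain F where F: "completely_commuting_filtration M F"
    and XF: "\<And>i. X i \<in> borel_measurable (F i)"
    and Xd: "\<And>i l. is_cond_exp M (F (i - axis l 1)) (X i) (\<lambda>_. 0)"
    using assms(8) unfolding orthomartingale_difference_def by blast
  interpret identically_distributed_orthomartingale M F X
    using assms(1,9) F XF Xd
    by (intro identically_distributed_orthomartingale.intro orthomartingale.intro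
        commuting_filtration.intro commuting_filtration_axioms.intro orthomartingale_axioms.intro
        identically_distributed_orthomartingale_axioms.intro) auto
  have p: "0 < p" "0 \<le> p" "p \<le> s" "0 < s" "p \<le> 2 * s" using assms(5,10) by auto
  have Xp: "integrable M (\<lambda>x. norm (X 1 x) powr p)"
    by (rule powr_integrable_smaller_exponent[OF X_measurable assms(11) p(2,3)])
  show ?thesis
  proof (intro conjI allI impI)
    fix n :: nat assume "1 \<le> n"
    then show "\<exists>S. has_Lp_sum M p (\<lambda>i \<omega>. A n i (X i \<omega>)) S"
      by (rule weighted_sum_exists[OF assms(4,3,5,6) Xp assms(7)])
  next
    fix S :: "nat \<Rightarrow> 'a \<Rightarrow> 'b" and R :: "nat \<Rightarrow> real" and \<epsilon> :: real
    assume S: "\<forall>n\<ge>1. has_Lp_sum M p (\<lambda>i \<omega>. A n i (X i \<omega>)) (S n)" and \<epsilon>: "\<epsilon> > 0"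
      and R0: "R 0 = 0" and Rpos: "\<forall>n\<ge>1. R n > 0" and Rmono: "mono_on {1..} R"
    \<comment> \<open>The exponent \<open>q = 2 * s\<close> lies above \<open>s\<close>, as the
      interpolation requires.\<close>
    obtain C where C: "0 \<le> C"
      "\<And>(a :: int ^ 'd \<Rightarrow> ('b \<Rightarrow>\<^sub>L 'b)) S R. (\<lambda>i. norm (a i) powr p) summable_on UNIV \<Longrightarrow>
         has_Lp_sum M p (\<lambda>i x. blinfun_apply (a i) (X i x)) S \<Longrightarrow> 0 < R \<Longrightarrow>
         prob {x \<in> space M. norm (S x) > \<epsilon> * lp_coeff_norm p a * R}
           \<le> C * (\<integral>x. truncated_powers p (2 * s) R (norm (X 1 x)) \<partial>M)"
      by (rule weighted_series_tail_bound[OF assms(4,3,5,6) p(5) Xp \<epsilon>]) blast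
    define w where "w n = R n powr s - R (n - 1) powr s" for n
    have w0: "0 \<le> w n" if "1 \<le> n" for n
    proof -
      have "0 \<le> R (n - 1) \<and> R (n - 1) \<le> R n"
        using that R0 Rpos mono_onD[OF Rmono, of "n - 1" n] by (cases "n = 1") (auto simp: less_imp_le)
      then show ?thesis using p by (simp add: w_def powr_mono2)
    qed
    define P where "P n = prob {\<omega> \<in> space M. norm (S n \<omega>) > \<epsilon> * lp_coeff_norm p (A n) * R n}" for n
    define T where "T n x = truncated_powers p (2 * s) (R n) (norm (X 1 x))" for n x
    have Tint: "integrable M (T n)" if "1 \<le> n" for n
      unfolding T_def[abs_def] using that Rpos p by (intro truncated_powers_integrable Xp) auto
    define B where "B = C * ((s / (s - p) + 2) * (\<integral>x. norm (X 1 x) powr s \<partial>M))"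
    have bound: "(\<Sum>n\<in>I. w n * P n) \<le> B" if I: "finite I" "I \<subseteq> {1..}" for I
    proof -
      have "(\<Sum>n\<in>I. w n * P n) \<le> (\<Sum>n\<in>I. w n * (C * (\<integral>x. T n x \<partial>M)))"
        unfolding P_def T_def using I S Rpos
        by (intro sum_mono mult_left_mono C(2) w0 assms(7)) auto
      also have "\<dots> = C * (\<Sum>n\<in>I. \<integral>x. w n * T n x \<partial>M)"
        by (simp add: sum_distrib_left mult_ac)
      also have "(\<Sum>n\<in>I. \<integral>x. w n * T n x \<partial>M) = (\<integral>x. (\<Sum>n\<in>I. w n * T n x) \<partial>M)"
        using I Tint by (intro Bochner_Integration.integral_sum[symmetric] integrable_mult_right) auto
      also have "\<dots> \<le> (\<integral>x. (s / (s - p) + 2) * norm (X 1 x) powr s \<partial>M)"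
      proof (rule integral_mono)
        show "integrable M (\<lambda>x. \<Sum>n\<in>I. w n * T n x)"
          using I Tint by (intro Bochner_Integration.integrable_sum integrable_mult_right) auto
        show "integrable M (\<lambda>x. (s / (s - p) + 2) * norm (X 1 x) powr s)"
          using assms(11) by (rule integrable_mult_right)
        show "(\<Sum>n\<in>I. w n * T n x) \<le> (s / (s - p) + 2) * norm (X 1 x) powr s" for x
          unfolding w_def T_def using Rpos
          by (intro sum_weighted_truncated_powers_le p assms(10) R0 Rmono I) auto
      qed
      finally show ?thesis using C(1) by (simp add: B_def mult_left_mono)
    qed
    have "(\<lambda>n. w n * P n) summable_on {1..}"
    proof (rule nonneg_bdd_above_summable_on)
      show "0 \<le> w n * P n" if "n \<in> {1..}" for n using that w0 by (simp add: P_def)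
      show "bdd_above (sum (\<lambda>n. w n * P n) ` {I. I \<subseteq> {1..} \<and> finite I})"
        using bound by (intro bdd_aboveI[of _ B]) auto
    qed
    then show "(\<lambda>n. (R n powr s - R (n - 1) powr s) *
            measure M {\<omega> \<in> space M. norm (S n \<omega>) > \<epsilon> * lp_coeff_norm p (A n) * R n}) summable_on {1..}"
      by (simp add: w_def P_def)
  qed
qed

end
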